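(* Let $X$ be a complex Banach space, $\alpha>0$, $T\in\mathcal{B}(X)$ a $(C,\alpha)$-bounded operator, and let $\mathfrak f\in A_+^\alpha(\mathbb{T})$ be of spectral synthesis in $A^\alpha(\mathbb{T})$ with respect to $\sigma(T)\cap\mathbb{T}$. Then $$\lim_{n\to\infty}\big\|M_T^\alpha(n)\,\theta_\alpha(\widehat{\mathfrak f})\big\|=0.$$
   Context: For $\gamma\in\mathbb{R}$, $k^\gamma(0)=1$, $k^\gamma(n)=\frac{\gamma(\gamma+1)\cdots(\gamma+n-1)}{n!}$ for $n\ge1$. For $T\in\mathcal{B}(X)$, $\Delta^{-\alpha}\mathcal{T}(n)=\sum_{j=0}^nk^\alpha(n-j)T^j$, $M_T^\alpha(n)=\Delta^{-\alpha}\mathcal{T}(n)/k^{\alpha+1}(n)$; $T$ is $(C,\alpha)$-bounded if $\sup_n\|M_T^\alpha(n)\|<\infty$. For a sequence $f$ on $\mathbb{Z}$: $W_+f(n)=f(n)-f(n+1)$, $W_-f(n)=f(n)-f(n-1)$, $W_\pm^m$ their powers; for $\alpha>0$, $W_+^{-\alpha}f(n)=\sum_{j\ge n}k^\alpha(j-n)f(j)$, $W_-^{-\alpha}f(n)=\sum_{j\le n}k^\alpha(n-j)f(j)$, $W_\pm^\alpha f=W_\pm^mW_\pm^{-(m-\alpha)}f$ with $m=[\alpha]+1$; $W^\alpha f(n)=W_+^\alpha f(n)$ for $n\ge0$, $=W_-^\alpha f(n)$ for $n<0$. $A^\alpha(\mathbb{T})$ is the space of continuous $2\pi$-periodic functions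 $\mathfrak f(t)=\sum_{n\in\mathbb{Z}}\widehat{\mathfrak f}(n)e^{int}$ ($\widehat{\mathfrak f}(n)$ the Fourier coefficients) with $\|\mathfrak f\|_{A^\alpha(\mathbb{T})}=\sum_{n\in\mathbb{Z}}k^{\alpha+1}(|n|)|W^\alpha\widehat{\mathfrak f}(n)|<\infty$; it is a Banach algebra (pointwise product, i.e. convolution of coefficients) with maximal ideal space $\mathbb{T}$. $A_+^\alpha(\mathbb{T})$ is the subalgebra with $\widehat{\mathfrak f}(n)=0$ for $n<0$. For a closed $E\subseteq\mathbb{T}$ (identified with $[0,2\pi)$ via $t\mapsto e^{it}$), $\mathfrak f\in A^\alpha(\mathbb{T})$ is of spectral synthesis with respect to $E$ if for every $\varepsilon>0$ there is $\mathfrak f_\varepsilon\in A^\alpha(\mathbb{T})$ with $\|\mathfrak f-\mathfrak f_\varepsilon\|_{A^\alpha(\mathbb{T})}<\varepsilon$ and $\mathfrak f_\varepsilon=0$ on a neighbourhood of $E$. For $(C,\alpha)$-bounded $T$ and $f$ on $\mathbb{N}_0$ with $\sum_{n\ge0}k^{\alpha+1}(n)|W_+^\alpha f(n)|<\infty$, $\theta_\alpha(f)=\sum_{n=0}^\infty W_+^\alpha f(n)\,\Delta^{-\alpha}\mathcal{T}(n)\in\mathcal{B}(X)$ (norm convergent series); $\theta_\alpha$ is a bounded algebra homomorphism. *)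

theory Defs
  imports "HOL-Analysis.Analysis"
begin

text \<open>A complex Banach space X is a real Banach space together with a bounded real-linear
  operator J (multiplication by i) with J o J = -I, such that the norm is a complex norm,
  i.e. norm ((cos t + i sin t) x) = norm x for all real t.\<close>

definition complex_structure :: "('a::banach \<Rightarrow>\<^sub>L 'a) \<Rightarrow> bool" where
  "complex_structure J \<longleftrightarrow> J o\<^sub>L J = - id_blinfun \<and>
     (\<forall>t x. norm (cos t *\<^sub>R x + sin t *\<^sub>R blinfun_apply J x) = norm x)"

definition cscaleL :: "('a::banach \<Rightarrow>\<^sub>L 'a) \<Rightarrow> complex \<Rightarrow> ('a \<Rightarrow>\<^sub>L 'a) \<Rightarrow> ('a \<Rightarrow>\<^sub>L 'a)" where
  "cscaleL J z A = Re z *\<^sub>R A + Im z *\<^sub>R (J o\<^sub>L A)"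

definition complex_linear_op :: "('a::banach \<Rightarrow>\<^sub>L 'a) \<Rightarrow> ('a \<Rightarrow>\<^sub>L 'a) \<Rightarrow> bool" where
  "complex_linear_op J T \<longleftrightarrow> T o\<^sub>L J = J o\<^sub>L T"

definition op_spectrum :: "('a::banach \<Rightarrow>\<^sub>L 'a) \<Rightarrow> ('a \<Rightarrow>\<^sub>L 'a) \<Rightarrow> complex set" where
  "op_spectrum J T = {z. \<not> (\<exists>S. complex_linear_op J S \<and>
      S o\<^sub>L (cscaleL J z id_blinfun - T) = id_blinfun \<and>
      (cscaleL J z id_blinfun - T) o\<^sub>L S = id_blinfun)}"

definition opow :: "('a::real_normed_vector \<Rightarrow>\<^sub>L 'a) \<Rightarrow> nat \<Rightarrow> ('a \<Rightarrow>\<^sub>L 'a)" where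
  "opow T j = ((\<lambda>S. T o\<^sub>L S) ^^ j) id_blinfun"

definition kc :: "real \<Rightarrow> nat \<Rightarrow> real" where
  "kc \<gamma> n = pochhammer \<gamma> n / fact n"

definition cesaro_sum :: "real \<Rightarrow> ('a::real_normed_vector \<Rightarrow>\<^sub>L 'a) \<Rightarrow> nat \<Rightarrow> ('a \<Rightarrow>\<^sub>L 'a)" where
  "cesaro_sum \<alpha> T n = (\<Sum>j\<le>n. kc \<alpha> (n - j) *\<^sub>R opow T j)"

definition cesaro_mean :: "real \<Rightarrow> ('a::real_normed_vector \<Rightarrow>\<^sub>L 'a) \<Rightarrow> nat \<Rightarrow> ('a \<Rightarrow>\<^sub>L 'a)" where
  "cesaro_mean \<alpha> T n = (1 / kc (\<alpha> + 1) n) *\<^sub>R cesaro_sum \<alpha> T n"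

definition C_bounded :: "real \<Rightarrow> ('a::real_normed_vector \<Rightarrow>\<^sub>L 'a) \<Rightarrow> bool" where
  "C_bounded \<alpha> T \<longleftrightarrow> (\<exists>C. \<forall>n. norm (cesaro_mean \<alpha> T n) \<le> C)"

definition Wp1 :: "(int \<Rightarrow> complex) \<Rightarrow> int \<Rightarrow> complex" where
  "Wp1 f n = f n - f (n + 1)"

definition Wm1 :: "(int \<Rightarrow> complex) \<Rightarrow> int \<Rightarrow> complex" where
  "Wm1 f n = f n - f (n - 1)"

definition Wp_neg :: "real \<Rightarrow> (int \<Rightarrow> complex) \<Rightarrow> int \<Rightarrow> complex" where
  "Wp_neg \<alpha> f n = infsum (\<lambda>j. of_real (kc \<alpha> (nat (j - n))) * f j) {n..}"

definition Wm_neg :: "real \<Rightarrow> (int \<Rightarrow> complex) \<Rightarrow> int \<Rightarrow> complex" where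
  "Wm_neg \<alpha> f n = infsum (\<lambda>j. of_real (kc \<alpha> (nat (n - j))) * f j) {..n}"

definition Wp :: "real \<Rightarrow> (int \<Rightarrow> complex) \<Rightarrow> int \<Rightarrow> complex" where
  "Wp \<alpha> f = (let m = nat (floor \<alpha>) + 1 in (Wp1 ^^ m) (Wp_neg (real m - \<alpha>) f))"

definition Wm :: "real \<Rightarrow> (int \<Rightarrow> complex) \<Rightarrow> int \<Rightarrow> complex" where
  "Wm \<alpha> f = (let m = nat (floor \<alpha>) + 1 in (Wm1 ^^ m) (Wm_neg (real m - \<alpha>) f))"

definition Wfrac :: "real \<Rightarrow> (int \<Rightarrow> complex) \<Rightarrow> int \<Rightarrow> complex" where
  "Wfrac \<alpha> f n = (if n \<ge> 0 then Wp \<alpha> f n else Wm \<alpha> f n)"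

definition fourier_coeff :: "(real \<Rightarrow> complex) \<Rightarrow> int \<Rightarrow> complex" where
  "fourier_coeff g n = (1 / (2 * pi)) * integral {0..2*pi} (\<lambda>t. g t * exp (- \<i> * of_int n * of_real t))"

definition A_norm :: "real \<Rightarrow> (real \<Rightarrow> complex) \<Rightarrow> real" where
  "A_norm \<alpha> g = infsum (\<lambda>n. kc (\<alpha> + 1) (nat \<bar>n\<bar>) * norm (Wfrac \<alpha> (fourier_coeff g) n)) UNIV"

definition A_alpha :: "real \<Rightarrow> (real \<Rightarrow> complex) set" where
  "A_alpha \<alpha> = {g. continuous_on UNIV g \<and> (\<forall>t. g (t + 2 * pi) = g t) \<and>
     (\<forall>t. ((\<lambda>n. fourier_coeff g n * exp (\<i> * of_int n * of_real t)) has_sum g t) UNIV) \<and>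
     (\<lambda>n. kc (\<alpha> + 1) (nat \<bar>n\<bar>) * norm (Wfrac \<alpha> (fourier_coeff g) n)) summable_on UNIV}"

definition A_alpha_plus :: "real \<Rightarrow> (real \<Rightarrow> complex) set" where
  "A_alpha_plus \<alpha> = {g \<in> A_alpha \<alpha>. \<forall>n<0. fourier_coeff g n = 0}"

text \<open>Spectral synthesis w.r.t. a closed subset E of the circle, given via its
  (2pi-periodic) preimage ER = {t. exp(i t) \<in> E} in R.\<close>
definition spectral_synthesis :: "real \<Rightarrow> (real \<Rightarrow> complex) \<Rightarrow> real set \<Rightarrow> bool" where
  "spectral_synthesis \<alpha> g ER \<longleftrightarrow> (\<forall>\<epsilon>>0. \<exists>h \<in> A_alpha \<alpha>.
      A_norm \<alpha> (\<lambda>t. g t - h t) < \<epsilon> \<and> (\<exists>U. open U \<and> ER \<subseteq> U \<and> (\<forall>t\<in>U. h t = 0)))"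

definition theta :: "('a::banach \<Rightarrow>\<^sub>L 'a) \<Rightarrow> real \<Rightarrow> ('a \<Rightarrow>\<^sub>L 'a) \<Rightarrow> (int \<Rightarrow> complex) \<Rightarrow> ('a \<Rightarrow>\<^sub>L 'a)" where
  "theta J \<alpha> T f = (\<Sum>n. cscaleL J (Wp \<alpha> f (int n)) (cesaro_sum \<alpha> T n))"

end

theory Submission
  imports Defs
begin

text \<open>
  Write \<open>M\<close> for the Cesaro means. Since \<open>T M(n) - M(n + 1) \<longrightarrow> 0\<close>, left multiplication by \<open>T\<close>
  on the Banach space of bounded operators acts along \<open>M\<close>, up to a null sequence, as the shift; that
  is, \<open>M\<close> is an asymptotic orbit. As the coefficients \<open>f\<close> of a function in \<open>A\<^sup>\<alpha>\<close> are
  recovered from \<open>W\<^sup>\<alpha> f\<close> by an absolutely convergent sum, \<open>M(n) \<theta>(f)\<close> equals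
  \<open>\<Sum>j. f(j) M(n + j)\<close> up to a null sequence, and the latter is bounded by the
  \<open>l\<^sup>1\<close> norm of \<open>f\<close>, hence by the \<open>A\<^sup>\<alpha>\<close> norm. It therefore suffices to treat
  \<open>h\<close> vanishing near the spectrum. The Abel means of the sum are integrals of \<open>h\<close> against the
  Poisson sums of the modulated orbits \<open>exp(- i k t) M(k)\<close>. Where \<open>h\<close> does not vanish, these are
  \<open>O(1 - r)\<close> up to a null sequence and uniformly in \<open>t\<close>, because the resolvent of \<open>T\<close> is
  bounded near the points \<open>exp(i t)\<close>.
\<close>

section \<open>Absolutely convergent sums\<close>

lemma has_sum_diff:
  fixes f g :: "'i \<Rightarrow> 'b::topological_ab_group_add"
  assumes "(f has_sum a) A" "(g has_sum b) A"
  shows "((\<lambda>i. f i - g i) has_sum (a - b)) A"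
  using has_sum_add[OF assms(1), of "\<lambda>i. - g i" "- b"] assms(2) by (simp add: has_sum_uminus)

lemma
  fixes f :: "'i \<Rightarrow> 'b::banach"
  assumes "M summable_on A" "\<And>i. i \<in> A \<Longrightarrow> norm (f i) \<le> M i"
  shows has_sum_infsum_dominated: "(f has_sum infsum f A) A"
    and norm_infsum_le_dominated: "norm (infsum f A) \<le> infsum M A"
proof -
  show sum: "(f has_sum infsum f A) A"
    by (rule has_sum_infsum[OF abs_summable_summable])
      (rule Infinite_Sum.abs_summable_on_comparison_test'[OF assms])
  show "norm (infsum f A) \<le> infsum M A"
    using sum has_sum_infsum[OF assms(1)] assms(2) by (rule norm_infsum_le)
qed

lemma tendsto_infsum_dominated:
  fixes a :: "'i \<Rightarrow> 'n \<Rightarrow> 'b::banach"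
  assumes lim: "\<And>i. i \<in> X \<Longrightarrow> (a i \<longlongrightarrow> b i) F"
    and bound: "\<forall>\<^sub>F n in F. \<forall>i\<in>X. norm (a i n) \<le> M i" and M: "M summable_on X"
    and F: "F \<noteq> bot"
  shows "((\<lambda>n. \<Sum>\<^sub>\<infinity>i\<in>X. a i n) \<longlongrightarrow> (\<Sum>\<^sub>\<infinity>i\<in>X. b i)) F"
proof (rule swap_uniform_limit')
  let ?S = "{n. \<forall>i\<in>X. norm (a i n) \<le> M i}"
  show "\<forall>\<^sub>F n in F. n \<in> ?S"
    using bound by simp
  show "uniform_limit ?S (\<lambda>Y n. \<Sum>i\<in>Y. a i n) (\<lambda>n. \<Sum>\<^sub>\<infinity>i\<in>X. a i n) (finite_subsets_at_top X)"
    by (rule Weierstrass_m_test_general[OF _ M]) blast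
  show "\<forall>\<^sub>F Y in finite_subsets_at_top X. ((\<lambda>n. \<Sum>i\<in>Y. a i n) \<longlongrightarrow> (\<Sum>i\<in>Y. b i)) F"
    by (rule eventually_finite_subsets_at_top_weakI) (auto intro!: tendsto_sum lim)
  have "norm (b i) \<le> M i" if "i \<in> X" for i
    by (rule tendsto_upperbound[OF tendsto_norm[OF lim[OF that]]])
      (use bound that F in \<open>auto elim: eventually_mono\<close>)
  then show "((\<lambda>Y. \<Sum>i\<in>Y. b i) \<longlongrightarrow> (\<Sum>\<^sub>\<infinity>i\<in>X. b i)) (finite_subsets_at_top X)"
    using has_sum_infsum_dominated[OF M] unfolding has_sum_def by blast
qed auto

lemma has_integral_infsum:
  fixes f :: "'i \<Rightarrow> real \<Rightarrow> 'b::banach"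
  assumes cont: "\<And>i. i \<in> A \<Longrightarrow> continuous_on {a..b} (f i)"
    and bound: "\<And>i t. i \<in> A \<Longrightarrow> t \<in> {a..b} \<Longrightarrow> norm (f i t) \<le> M i" and M: "M summable_on A"
  shows "((\<lambda>t. \<Sum>\<^sub>\<infinity>i\<in>A. f i t) has_integral (\<Sum>\<^sub>\<infinity>i\<in>A. integral {a..b} (f i))) {a..b}"
proof -
  define g where "g i = (if i \<in> A then f i else (\<lambda>t. 0))" for i
  have "uniform_limit {a..b} (\<lambda>Y t. \<Sum>i\<in>Y. g i t) (\<lambda>t. \<Sum>\<^sub>\<infinity>i\<in>A. g i t) (finite_subsets_at_top A)"
    by (rule Weierstrass_m_test_general[OF _ M]) (simp add: g_def bound)
  moreover have g_cont: "continuous_on {a..b} (g i)" for i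
    using cont by (simp add: g_def)
  ultimately obtain I J where I: "\<And>Y. ((\<lambda>t. \<Sum>i\<in>Y. g i t) has_integral I Y) {a..b}"
    and J: "((\<lambda>t. \<Sum>\<^sub>\<infinity>i\<in>A. g i t) has_integral J) {a..b}"
    and lim: "(I \<longlongrightarrow> J) (finite_subsets_at_top A)"
    by (rule uniform_limit_integral[OF _ continuous_on_sum]) auto
  have "I Y = (\<Sum>i\<in>Y. integral {a..b} (g i))" if "finite Y" for Y
    using I by (rule has_integral_unique)
      (intro has_integral_sum that integrable_integral integrable_continuous_interval g_cont)
  then have "\<forall>\<^sub>F Y in finite_subsets_at_top A. I Y = (\<Sum>i\<in>Y. integral {a..b} (g i))"
    by (intro eventually_finite_subsets_at_top_weakI) auto
  with lim have "((\<lambda>i. integral {a..b} (g i)) has_sum J) A"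
    unfolding has_sum_def by (simp add: tendsto_cong)
  moreover have "(\<Sum>\<^sub>\<infinity>i\<in>A. g i t) = (\<Sum>\<^sub>\<infinity>i\<in>A. f i t)" for t
    by (rule infsum_cong) (simp add: g_def)
  ultimately show ?thesis
    using J by (simp add: g_def infsumI cong: has_sum_cong infsum_cong)
qed

lemma
  fixes F :: "nat \<Rightarrow> nat \<Rightarrow> 'b::banach"
  assumes abs: "(\<lambda>k. \<Sum>j\<le>k. norm (F (k - j) j)) summable_on UNIV"
    and rows: "\<And>j. ((\<lambda>i. F i j) has_sum R j) UNIV"
  shows has_sum_rows: "(R has_sum (\<Sum>\<^sub>\<infinity>j. R j)) UNIV"
    and has_sum_antidiagonals: "((\<lambda>k. \<Sum>j\<le>k. F (k - j) j) has_sum (\<Sum>\<^sub>\<infinity>j. R j)) UNIV"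
proof -
  let ?D = "Sigma UNIV (\<lambda>k::nat. {..k})"
  define G where "G = (\<lambda>(k, j). F (k - j) j)"
  have "(\<lambda>k. norm (\<Sum>\<^sub>\<infinity>j\<in>{..k}. norm (G (k, j)))) summable_on UNIV"
    using abs by (simp add: G_def sum_nonneg)
  then have "(\<lambda>p. norm (G p)) summable_on ?D"
    by (subst Infinite_Sum.abs_summable_on_Sigma_iff) auto
  then have G: "(G has_sum infsum G ?D) ?D"
    by (rule has_sum_infsum[OF abs_summable_summable])
  moreover have "(G has_sum s) ?D \<longleftrightarrow> ((\<lambda>(j, i). F i j) has_sum s) (UNIV \<times> UNIV)" for s
    by (rule has_sum_reindex_bij_witness[where j = "\<lambda>(k, j). (j, k - j)"
        and i = "\<lambda>(j, i). (i + j, j)"])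
      (auto simp: G_def)
  ultimately have "((\<lambda>(j, i). F i j) has_sum infsum G ?D) (UNIV \<times> UNIV)"
    by blast
  then have R: "(R has_sum infsum G ?D) UNIV"
    by (rule has_sum_SigmaD) (use rows in simp)
  have "((\<lambda>k. \<Sum>j\<le>k. F (k - j) j) has_sum infsum G ?D) UNIV"
    by (rule has_sum_SigmaD[OF G]) (auto simp: G_def intro!: has_sum_finiteI)
  with R show "(R has_sum (\<Sum>\<^sub>\<infinity>j. R j)) UNIV"
    and "((\<lambda>k. \<Sum>j\<le>k. F (k - j) j) has_sum (\<Sum>\<^sub>\<infinity>j. R j)) UNIV"
    by (simp_all add: infsumI)
qed

lemma
  fixes v :: "int \<Rightarrow> 'b::banach"
  assumes "v summable_on UNIV"
  shows summable_on_int_nonneg: "(\<lambda>n. v (int n)) summable_on UNIV"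
    and summable_on_int_neg: "(\<lambda>n. v (- 1 - int n)) summable_on UNIV"
    and infsum_int_split: "infsum v UNIV = (\<Sum>\<^sub>\<infinity>n. v (int n)) + (\<Sum>\<^sub>\<infinity>n. v (- 1 - int n))"
proof -
  have nonneg: "(v has_sum s) {0..} \<longleftrightarrow> ((\<lambda>n. v (int n)) has_sum s) UNIV" for s
    by (rule has_sum_reindex_bij_witness[where i = int and j = nat]) auto
  have neg: "(v has_sum s) {..<0} \<longleftrightarrow> ((\<lambda>n. v (- 1 - int n)) has_sum s) UNIV" for s
    by (rule has_sum_reindex_bij_witness[where i = "\<lambda>n. - 1 - int n"
        and j = "\<lambda>n. nat (- 1 - n)"]) auto
  have summable: "v summable_on {0..}" "v summable_on {..<0}"
    using assms by (auto intro: summable_on_subset_banach)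
  then show "(\<lambda>n. v (int n)) summable_on UNIV" "(\<lambda>n. v (- 1 - int n)) summable_on UNIV"
    by (auto simp: summable_on_def nonneg neg)
  have "({0..} \<union> {..<0} :: int set) = UNIV"
    by auto
  then have "infsum v UNIV = infsum v {0..} + infsum v {..<0}"
    using infsum_Un_disjoint[OF summable] by (simp add: Int_absorb1 disjoint_iff)
  also have "infsum v {0..} = (\<Sum>\<^sub>\<infinity>n. v (int n))"
    using nonneg summable(1) by (metis has_sum_infsum infsumI)
  also have "infsum v {..<0} = (\<Sum>\<^sub>\<infinity>n. v (- 1 - int n))"
    using neg summable(2) by (metis has_sum_infsum infsumI)
  finally show "infsum v UNIV = (\<Sum>\<^sub>\<infinity>n. v (int n)) + (\<Sum>\<^sub>\<infinity>n. v (- 1 - int n))" .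
qed

lemma continuous_on_interval_norm_bounded:
  fixes h :: "real \<Rightarrow> 'b::real_normed_vector"
  assumes "continuous_on {a..b} h"
  obtains H where "\<And>t. t \<in> {a..b} \<Longrightarrow> norm (h t) \<le> H"
  using compact_imp_bounded[OF compact_continuous_image[OF assms compact_Icc]]
  unfolding bounded_iff by blast

lemma tendsto_0_by_approximation:
  fixes f :: "'a \<Rightarrow> 'b::real_normed_vector"
  assumes bound: "\<forall>\<^sub>F r in G. \<forall>n. norm (f n) \<le> b r n"
    and b: "\<forall>\<^sub>F r in G. (b r \<longlongrightarrow> l r) F" and l: "(l \<longlongrightarrow> 0) G" and G: "G \<noteq> bot"
  shows "(f \<longlongrightarrow> 0) F"
proof (rule tendstoI)
  fix e :: real assume "0 < e"
  then have "\<forall>\<^sub>F r in G. l r < e"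
    by (rule order_tendstoD(2)[OF l])
  with bound b have "\<forall>\<^sub>F r in G. (\<forall>n. norm (f n) \<le> b r n) \<and> (b r \<longlongrightarrow> l r) F \<and> l r < e"
    by eventually_elim blast
  then obtain r where r: "\<And>n. norm (f n) \<le> b r n" "(b r \<longlongrightarrow> l r) F" "l r < e"
    using G by (auto dest: eventually_happens)
  have "\<forall>\<^sub>F n in F. b r n < e"
    using r(2,3) by (rule order_tendstoD(2))
  then show "\<forall>\<^sub>F n in F. dist (f n) 0 < e"
    by eventually_elim (use r(1) in \<open>auto intro: le_less_trans\<close>)
qed

section \<open>Cesaro numbers\<close>

lemma kc_nonneg: "0 \<le> \<gamma> \<Longrightarrow> 0 \<le> kc \<gamma> n"
  by (simp add: kc_def pochhammer_prod prod_nonneg)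

lemma kc_pos: "0 < \<gamma> \<Longrightarrow> 0 < kc \<gamma> n"
  by (simp add: kc_def pochhammer_pos)

lemma kc_zero_left: "kc 0 n = (if n = 0 then 1 else 0)"
  by (simp add: kc_def pochhammer_0_left)

lemma kc_one_left [simp]: "kc 1 n = 1"
  by (simp add: kc_def pochhammer_fact[symmetric])

lemma kc_Suc: "kc \<gamma> (Suc n) = kc \<gamma> n * ((\<gamma> + n) / (n + 1))"
  by (simp add: kc_def pochhammer_Suc divide_simps)

lemma kc_mono_left:
  assumes "0 \<le> a" "a \<le> b"
  shows "kc a n \<le> kc b n"
  using assms unfolding kc_def pochhammer_prod
  by (intro divide_right_mono prod_mono) auto

lemma kc_mono_right:
  assumes "1 \<le> \<gamma>" "m \<le> n"
  shows "kc \<gamma> m \<le> kc \<gamma> n"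
proof (rule lift_Suc_mono_le[of "kc \<gamma>", OF _ assms(2)])
  fix k
  have "kc \<gamma> k * 1 \<le> kc \<gamma> k * ((\<gamma> + k) / (k + 1))"
    using assms(1) by (intro mult_left_mono kc_nonneg) auto
  then show "kc \<gamma> k \<le> kc \<gamma> (Suc k)"
    by (simp add: kc_Suc)
qed

lemma kc_convolution: "(\<Sum>i\<le>n. kc a i * kc b (n - i)) = kc (a + b) n"
  unfolding kc_def pochhammer_binomial_sum sum_divide_distrib
  by (intro sum.cong refl) (simp add: binomial_fact)

lemma sum_kc: "(\<Sum>i\<le>n. kc a (n - i)) = kc (a + 1) n"
  using kc_convolution[of 1 a n] by (simp add: add.commute)

lemma kc_ratio_add_one:
  assumes "0 < \<alpha>"
  shows "kc \<alpha> n / kc (\<alpha> + 1) n = \<alpha> / (\<alpha> + n)"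
proof -
  have "kc (\<alpha> + 1) n * \<alpha> = kc \<alpha> n * (\<alpha> + n)"
    unfolding kc_def using pochhammer_rec[of \<alpha> n] pochhammer_Suc[of \<alpha> n] by simp
  then show ?thesis
    using assms kc_pos[of "\<alpha> + 1" n] by (simp add: field_simps)
qed

section \<open>Weyl sums and their inversion\<close>

definition kc_summable :: "real \<Rightarrow> (nat \<Rightarrow> 'b::real_normed_vector) \<Rightarrow> bool" where
  "kc_summable \<gamma> u \<longleftrightarrow> (\<lambda>k. kc \<gamma> k * norm (u k)) summable_on UNIV"

lemma kc_summable_one_iff: "kc_summable 1 u \<longleftrightarrow> (\<lambda>k. norm (u k)) summable_on UNIV"
  by (simp add: kc_summable_def)

lemma kc_summable_norm_iff [simp]: "kc_summable \<gamma> (\<lambda>k. norm (u k)) \<longleftrightarrow> kc_summable \<gamma> u"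
  by (simp add: kc_summable_def)

lemma kc_summable_mono:
  assumes "kc_summable \<delta> u" "0 \<le> \<gamma>" "\<gamma> \<le> \<delta>"
  shows "kc_summable \<gamma> u"
  unfolding kc_summable_def
  by (rule summable_on_comparison_test[OF assms(1)[unfolded kc_summable_def]])
     (use assms in \<open>auto intro!: mult_right_mono mult_nonneg_nonneg kc_mono_left kc_nonneg\<close>)

lemma kc_summable_shift:
  assumes "kc_summable \<gamma> u" "1 \<le> \<gamma>"
  shows "kc_summable \<gamma> (\<lambda>k. u (n + k))"
proof -
  have "(\<lambda>k. kc \<gamma> k * norm (u k)) summable_on range ((+) n)"
    using assms(1) unfolding kc_summable_def by (rule summable_on_subset_banach) simp
  then have "(\<lambda>k. kc \<gamma> (n + k) * norm (u (n + k))) summable_on UNIV"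
    by (subst (asm) summable_on_reindex) (auto simp: o_def)
  then show ?thesis
    unfolding kc_summable_def
    by (rule summable_on_comparison_test)
       (use assms(2) in \<open>auto intro!: mult_right_mono mult_nonneg_nonneg kc_mono_right kc_nonneg\<close>)
qed

definition weyl_sum :: "real \<Rightarrow> (nat \<Rightarrow> 'b::banach) \<Rightarrow> nat \<Rightarrow> 'b" where
  "weyl_sum a u n = (\<Sum>\<^sub>\<infinity>k. kc a k *\<^sub>R u (n + k))"

lemma weyl_sum_shift: "weyl_sum a u (n + j) = weyl_sum a (\<lambda>k. u (n + k)) j"
  by (simp add: weyl_sum_def add.assoc)

lemma weyl_sum_zero: "weyl_sum 0 u = u"
proof
  fix n
  have "weyl_sum 0 u n = (\<Sum>\<^sub>\<infinity>k\<in>{0}. kc 0 k *\<^sub>R u (n + k))"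
    unfolding weyl_sum_def by (rule infsum_cong_neutral) (auto simp: kc_zero_left)
  then show "weyl_sum 0 u n = u n"
    by (simp add: kc_zero_left)
qed

lemma
  assumes "kc_summable \<gamma> u" "0 \<le> a" "a \<le> \<gamma>" "1 \<le> \<gamma>"
  shows weyl_sum_has_sum: "((\<lambda>k. kc a k *\<^sub>R u (n + k)) has_sum weyl_sum a u n) UNIV"
    and norm_weyl_sum_le: "norm (weyl_sum a u n) \<le> weyl_sum a (\<lambda>k. norm (u k)) n"
proof -
  have summable: "(\<lambda>k. kc a k * norm (u (n + k))) summable_on UNIV"
    using kc_summable_mono[OF kc_summable_shift] assms by (auto simp: kc_summable_def)
  show "((\<lambda>k. kc a k *\<^sub>R u (n + k)) has_sum weyl_sum a u n) UNIV"
    unfolding weyl_sum_def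
    by (rule has_sum_infsum_dominated[OF summable]) (use assms in \<open>simp add: kc_nonneg\<close>)
  have "norm (weyl_sum a u n) \<le> (\<Sum>\<^sub>\<infinity>k. kc a k * norm (u (n + k)))"
    unfolding weyl_sum_def
    by (rule norm_infsum_le_dominated[OF summable]) (use assms in \<open>simp add: kc_nonneg\<close>)
  then show "norm (weyl_sum a u n) \<le> weyl_sum a (\<lambda>k. norm (u k)) n"
    by (simp add: weyl_sum_def)
qed

lemma weyl_sum_one_sums:
  assumes "kc_summable 1 u"
  shows "(\<lambda>k. u (n + k)) sums weyl_sum 1 u n"
  using has_sum_imp_sums[OF weyl_sum_has_sum[OF assms, of 1 n]] by simp

lemma weyl_sum_diff:
  assumes u: "kc_summable \<gamma> u" and v: "kc_summable \<gamma> v" and "0 \<le> a" "a \<le> \<gamma>" "1 \<le> \<gamma>"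
  shows "weyl_sum a (\<lambda>k. u k - v k) n = weyl_sum a u n - weyl_sum a v n"
proof -
  have "((\<lambda>k. kc a k *\<^sub>R u (n + k) - kc a k *\<^sub>R v (n + k))
      has_sum weyl_sum a u n - weyl_sum a v n) UNIV"
    by (intro has_sum_diff weyl_sum_has_sum[OF u] weyl_sum_has_sum[OF v] assms)
  then show ?thesis
    unfolding weyl_sum_def[of a "\<lambda>k. u k - v k"]
    by (intro infsumI) (simp add: scaleR_right_diff_distrib)
qed

lemma
  fixes prod :: "'a::real_normed_vector \<Rightarrow> 'b::banach \<Rightarrow> 'c::banach"
  assumes "bounded_bilinear prod" and "0 \<le> a" "0 \<le> b" "1 \<le> a + b"
    and x: "\<And>j. norm (x j) \<le> C * kc a j" and u: "kc_summable (a + b) u"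
  shows has_sum_prod_weyl_sum:
      "((\<lambda>j. prod (x j) (weyl_sum b u j)) has_sum (\<Sum>\<^sub>\<infinity>j. prod (x j) (weyl_sum b u j))) UNIV"
    and has_sum_cesaro_sum_prod:
      "((\<lambda>k. prod (\<Sum>j\<le>k. kc b (k - j) *\<^sub>R x j) (u k))
          has_sum (\<Sum>\<^sub>\<infinity>j. prod (x j) (weyl_sum b u j))) UNIV"
proof -
  interpret prod: bounded_bilinear prod by fact
  obtain K where K: "0 \<le> K" "\<And>y z. norm (prod y z) \<le> norm y * norm z * K"
    using prod.nonneg_bounded by blast
  define F where "F i j = prod (kc b i *\<^sub>R x j) (u (j + i))" for i j
  have norm_F: "norm (F i j) \<le> (kc a j * kc b i) * (C * K * norm (u (j + i)))" for i j
  proof -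
    have "norm (F i j) \<le> norm (kc b i *\<^sub>R x j) * norm (u (j + i)) * K"
      unfolding F_def by (rule K)
    also have "\<dots> \<le> (kc b i * (C * kc a j)) * norm (u (j + i)) * K"
      using assms K(1) by (intro mult_right_mono) (auto simp: kc_nonneg intro!: mult_left_mono x)
    finally show ?thesis by (simp add: mult_ac)
  qed
  have "(\<lambda>k. C * K * (kc (a + b) k * norm (u k))) summable_on UNIV"
    using u unfolding kc_summable_def by (rule summable_on_cmult_right)
  then have abs: "(\<lambda>k. \<Sum>j\<le>k. norm (F (k - j) j)) summable_on UNIV"
  proof (rule summable_on_comparison_test)
    fix k
    have "(\<Sum>j\<le>k. norm (F (k - j) j)) \<le> (\<Sum>j\<le>k. (kc a j * kc b (k - j)) * (C * K * norm (u k)))"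
      using norm_F[of "k - j" j for j] by (intro sum_mono) (metis atMost_iff le_add_diff_inverse)
    also have "\<dots> = C * K * (kc (a + b) k * norm (u k))"
      by (simp add: kc_convolution sum_distrib_right[symmetric])
    finally show "(\<Sum>j\<le>k. norm (F (k - j) j)) \<le> C * K * (kc (a + b) k * norm (u k))" .
  qed (simp add: sum_nonneg)
  have rows: "((\<lambda>i. F i j) has_sum prod (x j) (weyl_sum b u j)) UNIV" for j
    using has_sum_bounded_linear[OF prod.bounded_linear_right weyl_sum_has_sum[OF u]] assms
    by (simp add: F_def prod.scaleR_left prod.scaleR_right)
  have diagonal: "(\<Sum>j\<le>k. F (k - j) j) = prod (\<Sum>j\<le>k. kc b (k - j) *\<^sub>R x j) (u k)" for k
    by (simp add: F_def prod.sum_left)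
  show "((\<lambda>j. prod (x j) (weyl_sum b u j)) has_sum (\<Sum>\<^sub>\<infinity>j. prod (x j) (weyl_sum b u j))) UNIV"
    and "((\<lambda>k. prod (\<Sum>j\<le>k. kc b (k - j) *\<^sub>R x j) (u k))
        has_sum (\<Sum>\<^sub>\<infinity>j. prod (x j) (weyl_sum b u j))) UNIV"
    using has_sum_rows[OF abs rows] has_sum_antidiagonals[OF abs rows] by (simp_all add: diagonal)
qed

lemma weyl_sum_weyl_sum:
  assumes "kc_summable (a + b) u" "0 \<le> a" "0 \<le> b" "1 \<le> a + b"
  shows "weyl_sum a (weyl_sum b u) = weyl_sum (a + b) u"
proof
  fix n
  let ?v = "\<lambda>k. u (n + k)"
  have "((\<lambda>k. (\<Sum>j\<le>k. kc b (k - j) *\<^sub>R kc a j) *\<^sub>R ?v k) has_sum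
      (\<Sum>\<^sub>\<infinity>j. kc a j *\<^sub>R weyl_sum b ?v j)) UNIV"
    by (rule has_sum_cesaro_sum_prod[OF bounded_bilinear_scaleR, where C = 1 and a = a])
      (use assms in \<open>auto simp: kc_nonneg intro: kc_summable_shift\<close>)
  then have "((\<lambda>k. kc (a + b) k *\<^sub>R ?v k) has_sum weyl_sum a (weyl_sum b u) n) UNIV"
    by (simp add: kc_convolution[symmetric] mult.commute weyl_sum_def[of a] weyl_sum_shift)
  then show "weyl_sum a (weyl_sum b u) n = weyl_sum (a + b) u n"
    by (simp add: weyl_sum_def[of "a + b"] infsumI)
qed

lemma
  assumes u: "kc_summable (a + b) u" and "0 \<le> a" "0 \<le> b" "1 \<le> a + b"
  shows kc_summable_weyl_sum: "kc_summable a (weyl_sum b u)"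
    and infsum_kc_weyl_sum_le:
      "(\<Sum>\<^sub>\<infinity>k. kc a k * norm (weyl_sum b u k)) \<le> (\<Sum>\<^sub>\<infinity>k. kc (a + b) k * norm (u k))"
proof -
  let ?v = "\<lambda>k. norm (u k)"
  have majorant: "((\<lambda>j. kc a j *\<^sub>R weyl_sum b ?v j) has_sum (\<Sum>\<^sub>\<infinity>j. kc a j *\<^sub>R weyl_sum b ?v j)) UNIV"
    by (rule has_sum_prod_weyl_sum[OF bounded_bilinear_scaleR, where C = 1 and a = a])
      (use assms in \<open>auto simp: kc_nonneg\<close>)
  have "((\<lambda>k. (\<Sum>j\<le>k. kc b (k - j) *\<^sub>R kc a j) *\<^sub>R ?v k) has_sum
      (\<Sum>\<^sub>\<infinity>j. kc a j *\<^sub>R weyl_sum b ?v j)) UNIV"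
    by (rule has_sum_cesaro_sum_prod[OF bounded_bilinear_scaleR, where C = 1 and a = a])
      (use assms in \<open>auto simp: kc_nonneg\<close>)
  then have total: "(\<Sum>\<^sub>\<infinity>j. kc a j * weyl_sum b ?v j) = (\<Sum>\<^sub>\<infinity>k. kc (a + b) k * norm (u k))"
    by (simp add: kc_convolution[symmetric] mult.commute infsumI)
  have term_le: "kc a k * norm (weyl_sum b u k) \<le> kc a k * weyl_sum b ?v k" for k
    using assms by (intro mult_left_mono norm_weyl_sum_le[OF u]) (auto simp: kc_nonneg)
  have majorant_summable: "(\<lambda>j. kc a j * weyl_sum b ?v j) summable_on UNIV"
    using has_sum_imp_summable[OF majorant] by simp
  then show summable: "kc_summable a (weyl_sum b u)"
    unfolding kc_summable_def
    by (rule summable_on_comparison_test) (use assms term_le in \<open>auto simp: kc_nonneg\<close>)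
  show "(\<Sum>\<^sub>\<infinity>k. kc a k * norm (weyl_sum b u k)) \<le> (\<Sum>\<^sub>\<infinity>k. kc (a + b) k * norm (u k))"
    unfolding total[symmetric]
    by (rule infsum_mono) (use summable majorant_summable term_le in \<open>auto simp: kc_summable_def\<close>)
qed

lemma weyl_sum_tendsto_0:
  assumes u: "kc_summable 1 u" and "0 \<le> a" "a \<le> 1"
  shows "weyl_sum a u \<longlonglongrightarrow> 0"
proof (rule Lim_null_comparison)
  let ?v = "\<lambda>k. norm (u k)"
  have tail: "weyl_sum 1 ?v n = (\<Sum>k. ?v (k + n))" for n
    using weyl_sum_one_sums[of ?v n] u by (simp add: sums_iff add.commute)
  have "summable ?v"
    using u by (simp add: kc_summable_one_iff summable_on_imp_summable)
  then show "(\<lambda>n. weyl_sum 1 ?v n) \<longlonglongrightarrow> 0"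
    unfolding tail by (rule suminf_exist_split2)
  have "weyl_sum a ?v n \<le> weyl_sum 1 ?v n" for n
    by (rule has_sum_mono[OF weyl_sum_has_sum[of 1 ?v a] weyl_sum_has_sum[of 1 ?v 1]])
      (use assms kc_mono_left[of a 1] in \<open>auto intro: mult_left_le_one_le simp: kc_nonneg\<close>)
  then show "\<forall>\<^sub>F n in sequentially. norm (weyl_sum a u n) \<le> weyl_sum 1 ?v n"
    using assms by (intro always_eventually allI order_trans[OF norm_weyl_sum_le[OF u]]) auto
qed

definition fdiff :: "(nat \<Rightarrow> 'b::ab_group_add) \<Rightarrow> nat \<Rightarrow> 'b" where
  "fdiff u n = u n - u (Suc n)"

lemma fdiff_tendsto_0:
  fixes u :: "nat \<Rightarrow> 'b::real_normed_vector"
  shows "u \<longlonglongrightarrow> 0 \<Longrightarrow> fdiff u \<longlonglongrightarrow> 0"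
  unfolding fdiff_def using tendsto_diff[OF _ LIMSEQ_Suc, of u 0 u 0] by simp

lemma fdiff_funpow_diff: "(fdiff ^^ m) (\<lambda>k. u k - v k) n = (fdiff ^^ m) u n - (fdiff ^^ m) v n"
  by (induction m arbitrary: n) (simp_all add: fdiff_def)

lemma weyl_sum_one_fdiff:
  fixes u :: "nat \<Rightarrow> 'b::banach"
  assumes "kc_summable 1 (fdiff u)" "u \<longlonglongrightarrow> 0"
  shows "weyl_sum 1 (fdiff u) = u"
proof
  fix n
  have "(\<lambda>k. u (n + k)) \<longlonglongrightarrow> 0"
    using LIMSEQ_ignore_initial_segment[OF assms(2), of n] by (simp add: add.commute)
  from telescope_sums'[OF this] show "weyl_sum 1 (fdiff u) n = u n"
    using weyl_sum_one_sums[OF assms(1), of n] by (simp add: fdiff_def sums_iff)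
qed

lemma fdiff_weyl_sum_one:
  fixes u :: "nat \<Rightarrow> 'b::banach"
  assumes "kc_summable 1 u"
  shows "fdiff (weyl_sum 1 u) = u"
proof
  fix n
  have "(\<lambda>k. u (n + Suc k)) sums (weyl_sum 1 u n - u n)"
    using weyl_sum_one_sums[OF assms, of n] by (subst sums_Suc_iff) simp
  with weyl_sum_one_sums[OF assms, of "Suc n"] show "fdiff (weyl_sum 1 u) n = u n"
    by (simp add: fdiff_def sums_iff)
qed

lemma weyl_sum_fdiff_funpow:
  fixes u :: "nat \<Rightarrow> 'b::banach"
  assumes "kc_summable m ((fdiff ^^ m) u)" "u \<longlonglongrightarrow> 0"
  shows "weyl_sum m ((fdiff ^^ m) u) = u"
  using assms
proof (induction m arbitrary: u)
  case 0
  then show ?case by (simp add: weyl_sum_zero)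
next
  case (Suc m)
  let ?g = "(fdiff ^^ Suc m) u"
  have g: "kc_summable (1 + real m) ?g"
    using Suc.prems(1) by simp
  have g_eq: "?g = (fdiff ^^ m) (fdiff u)"
    by (simp only: funpow_Suc_right o_apply)
  have "kc_summable m ((fdiff ^^ m) (fdiff u))"
    unfolding g_eq[symmetric] by (rule kc_summable_mono[OF g]) auto
  then have IH: "weyl_sum m ?g = fdiff u"
    unfolding g_eq by (rule Suc.IH) (rule fdiff_tendsto_0[OF Suc.prems(2)])
  have "weyl_sum (Suc m) ?g = weyl_sum 1 (weyl_sum m ?g)"
    using weyl_sum_weyl_sum[OF g] by simp
  also have "\<dots> = u"
    using kc_summable_weyl_sum[OF g] Suc.prems(2) unfolding IH by (intro weyl_sum_one_fdiff) auto
  finally show ?case .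
qed

definition weyl_diff :: "real \<Rightarrow> (nat \<Rightarrow> 'b::banach) \<Rightarrow> nat \<Rightarrow> 'b" where
  "weyl_diff \<alpha> u = (let m = nat \<lfloor>\<alpha>\<rfloor> + 1 in (fdiff ^^ m) (weyl_sum (real m - \<alpha>) u))"

lemma weyl_diff_diff:
  assumes "0 < \<alpha>" "kc_summable 1 u" "kc_summable 1 v"
  shows "weyl_diff \<alpha> (\<lambda>k. u k - v k) n = weyl_diff \<alpha> u n - weyl_diff \<alpha> v n"
proof -
  let ?b = "real (nat \<lfloor>\<alpha>\<rfloor> + 1) - \<alpha>"
  have "0 \<le> ?b" "?b \<le> 1"
    using assms(1) by linarith+
  then have "weyl_sum ?b (\<lambda>k. u k - v k) = (\<lambda>k. weyl_sum ?b u k - weyl_sum ?b v k)"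
    using assms by (intro ext weyl_sum_diff) auto
  then show ?thesis
    unfolding weyl_diff_def Let_def by (simp only: fdiff_funpow_diff)
qed

text \<open>Put \<open>b = m - \<alpha>\<close>. The Weyl sums of order \<open>b\<close> of \<open>u\<close> and of
  \<open>weyl_sum \<alpha> g\<close> are null sequences with the same \<open>m\<close>-th difference, so they agree;
  a further Weyl sum of order \<open>1 - b\<close> followed by \<open>fdiff\<close> undoes the one of order \<open>b\<close>.\<close>
lemma weyl_sum_weyl_diff:
  assumes "0 < \<alpha>" and u: "kc_summable 1 u" and summable: "kc_summable (\<alpha> + 1) (weyl_diff \<alpha> u)"
  shows "weyl_sum \<alpha> (weyl_diff \<alpha> u) = u"
proof -
  define m where "m = nat \<lfloor>\<alpha>\<rfloor> + 1"
  define b where "b = real m - \<alpha>"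
  define g where "g = weyl_diff \<alpha> u"
  have b: "0 \<le> b" "b \<le> 1" "b + \<alpha> = real m" "1 \<le> real m"
    using assms(1) unfolding b_def m_def by linarith+
  have g_eq: "g = (fdiff ^^ m) (weyl_sum b u)"
    by (simp add: g_def weyl_diff_def b_def m_def)
  have g: "kc_summable (b + \<alpha>) g"
    by (rule kc_summable_mono[OF summable[folded g_def]]) (use b assms(1) in auto)
  have wg: "kc_summable 1 (weyl_sum \<alpha> g)"
    using summable assms(1) by (intro kc_summable_weyl_sum) (auto simp: g_def add.commute)
  have "weyl_sum b (weyl_sum \<alpha> g) = weyl_sum m g"
    using weyl_sum_weyl_sum[OF g] b assms(1) by simp
  also have "\<dots> = weyl_sum b u"
    unfolding g_eq
    by (rule weyl_sum_fdiff_funpow) (use g b in \<open>auto simp: g_eq intro: weyl_sum_tendsto_0 u\<close>)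
  finally have sums_eq: "weyl_sum b (weyl_sum \<alpha> g) = weyl_sum b u" .
  have "weyl_sum 1 v = weyl_sum (1 - b) (weyl_sum b v)" if "kc_summable 1 v" for v :: "nat \<Rightarrow> 'a"
    using weyl_sum_weyl_sum[of "1 - b" b v] that b by simp
  then have "weyl_sum 1 (weyl_sum \<alpha> g) = weyl_sum 1 u"
    using u wg sums_eq by simp
  then show ?thesis
    unfolding g_def[symmetric] using fdiff_weyl_sum_one[OF u] fdiff_weyl_sum_one[OF wg] by simp
qed

section \<open>The algebra \<open>A\<^sup>\<alpha>\<close> of the circle\<close>

lemma Wp_nat: "Wp \<alpha> f (int n) = weyl_diff \<alpha> (\<lambda>k. f (int k)) n"
proof -
  have sum: "Wp_neg a f (int n) = weyl_sum a (\<lambda>k. f (int k)) n" for a n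
    unfolding Wp_neg_def weyl_sum_def
    by (rule infsum_reindex_bij_witness[where i = "\<lambda>k. int (n + k)" and j = "\<lambda>j. nat (j - int n)"])
       (auto simp: scaleR_conv_of_real)
  have succ: "int n + 1 = int (Suc n)" for n
    by simp
  have diff: "(Wp1 ^^ m) F (int n) = (fdiff ^^ m) (\<lambda>k. F (int k)) n" for m F n
    by (induction m arbitrary: n)
      (simp_all only: funpow.simps o_apply id_apply Wp1_def fdiff_def succ)
  show ?thesis
    by (simp only: Wp_def weyl_diff_def Let_def diff sum)
qed

lemma Wm_nat: "Wm \<alpha> f (- 1 - int n) = weyl_diff \<alpha> (\<lambda>k. f (- 1 - int k)) n"
proof -
  have sum: "Wm_neg a f (- 1 - int n) = weyl_sum a (\<lambda>k. f (- 1 - int k)) n" for a n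
    unfolding Wm_neg_def weyl_sum_def
    by (rule infsum_reindex_bij_witness[where i = "\<lambda>k. - 1 - int (n + k)"
        and j = "\<lambda>j. nat (- 1 - int n - j)"])
       (auto simp: scaleR_conv_of_real)
  have pred: "- 1 - int n - 1 = - 1 - int (Suc n)" for n
    by simp
  have diff: "(Wm1 ^^ m) F (- 1 - int n) = (fdiff ^^ m) (\<lambda>k. F (- 1 - int k)) n" for m F n
    by (induction m arbitrary: n)
      (simp_all only: funpow.simps o_apply id_apply Wm1_def fdiff_def pred)
  show ?thesis
    by (simp only: Wm_def weyl_diff_def Let_def diff sum)
qed

lemma Wfrac_nonneg: "Wfrac \<alpha> f (int n) = weyl_diff \<alpha> (\<lambda>k. f (int k)) n"
  by (simp add: Wfrac_def Wp_nat)

lemma Wfrac_neg: "Wfrac \<alpha> f (- 1 - int n) = weyl_diff \<alpha> (\<lambda>k. f (- 1 - int k)) n"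
  by (simp add: Wfrac_def Wm_nat)

lemma Wfrac_diff:
  assumes "0 < \<alpha>" and f: "(\<lambda>n. norm (f n)) summable_on UNIV"
    and g: "(\<lambda>n. norm (g n)) summable_on UNIV"
  shows "Wfrac \<alpha> (\<lambda>n. f n - g n) n = Wfrac \<alpha> f n - Wfrac \<alpha> g n"
proof (cases "0 \<le> n")
  case True
  then obtain k where "n = int k"
    using nonneg_int_cases by blast
  then show ?thesis
    using assms(1) summable_on_int_nonneg[OF f] summable_on_int_nonneg[OF g]
    by (simp add: Wfrac_nonneg weyl_diff_diff kc_summable_one_iff)
next
  case False
  then have "n = - 1 - int (nat (- 1 - n))"
    by simp
  then obtain k where n: "n = - 1 - int k"
    by blast
  show ?thesis
    using assms(1) summable_on_int_neg[OF f] summable_on_int_neg[OF g]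
    unfolding n Wfrac_neg by (simp add: weyl_diff_diff kc_summable_one_iff)
qed

lemma l1_norm_le_weyl_diff:
  assumes "0 < \<alpha>" "kc_summable 1 u" "kc_summable (\<alpha> + 1) (weyl_diff \<alpha> u)"
  shows "(\<Sum>\<^sub>\<infinity>k. norm (u k)) \<le> (\<Sum>\<^sub>\<infinity>k. kc (\<alpha> + 1) k * norm (weyl_diff \<alpha> u k))"
  using infsum_kc_weyl_sum_le[of 1 \<alpha> "weyl_diff \<alpha> u"] assms
  by (simp add: weyl_sum_weyl_diff add.commute)

lemma l1_norm_le_Wfrac:
  assumes "0 < \<alpha>" and f: "(\<lambda>n. norm (f n)) summable_on UNIV"
    and W: "(\<lambda>n. kc (\<alpha> + 1) (nat \<bar>n\<bar>) * norm (Wfrac \<alpha> f n)) summable_on UNIV"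
  shows "(\<Sum>\<^sub>\<infinity>n. norm (f n)) \<le> (\<Sum>\<^sub>\<infinity>n. kc (\<alpha> + 1) (nat \<bar>n\<bar>) * norm (Wfrac \<alpha> f n))"
proof -
  let ?p = "\<lambda>k. f (int k)" and ?m = "\<lambda>k. f (- 1 - int k)"
  have abs_neg: "nat \<bar>- 1 - int n\<bar> = Suc n" for n
    by simp
  have pos: "kc_summable 1 ?p" and neg: "kc_summable 1 ?m"
    using summable_on_int_nonneg[OF f] summable_on_int_neg[OF f] by (auto simp: kc_summable_one_iff)
  have W_pos: "kc_summable (\<alpha> + 1) (weyl_diff \<alpha> ?p)"
    using summable_on_int_nonneg[OF W] by (simp add: Wfrac_nonneg kc_summable_def)
  have W_neg_Suc: "(\<lambda>n. kc (\<alpha> + 1) (Suc n) * norm (weyl_diff \<alpha> ?m n)) summable_on UNIV"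
    using summable_on_int_neg[OF W] by (simp only: Wfrac_neg abs_neg)
  have weight_le:
    "kc (\<alpha> + 1) n * norm (weyl_diff \<alpha> ?m n) \<le> kc (\<alpha> + 1) (Suc n) * norm (weyl_diff \<alpha> ?m n)" for n
    using assms(1) by (intro mult_right_mono kc_mono_right) auto
  have W_neg: "kc_summable (\<alpha> + 1) (weyl_diff \<alpha> ?m)"
    unfolding kc_summable_def
    by (rule summable_on_comparison_test[OF W_neg_Suc weight_le])
       (use assms(1) in \<open>auto simp: kc_nonneg\<close>)
  have "(\<Sum>\<^sub>\<infinity>n. norm (f n)) = (\<Sum>\<^sub>\<infinity>n. norm (?p n)) + (\<Sum>\<^sub>\<infinity>n. norm (?m n))"
    by (rule infsum_int_split[OF f])
  also have "\<dots> \<le> (\<Sum>\<^sub>\<infinity>n. kc (\<alpha> + 1) n * norm (weyl_diff \<alpha> ?p n))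
      + (\<Sum>\<^sub>\<infinity>n. kc (\<alpha> + 1) n * norm (weyl_diff \<alpha> ?m n))"
    by (intro add_mono l1_norm_le_weyl_diff assms(1) pos neg W_pos W_neg)
  also have "\<dots> \<le> (\<Sum>\<^sub>\<infinity>n. kc (\<alpha> + 1) n * norm (weyl_diff \<alpha> ?p n))
      + (\<Sum>\<^sub>\<infinity>n. kc (\<alpha> + 1) (Suc n) * norm (weyl_diff \<alpha> ?m n))"
    by (intro add_left_mono infsum_mono W_neg[unfolded kc_summable_def] W_neg_Suc weight_le)
  also have "\<dots> = (\<Sum>\<^sub>\<infinity>n. kc (\<alpha> + 1) (nat \<bar>n\<bar>) * norm (Wfrac \<alpha> f n))"
    unfolding infsum_int_split[OF W] Wfrac_neg Wfrac_nonneg abs_neg by simp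
  finally show ?thesis .
qed

lemma integrable_fourier_integrand:
  fixes g :: "real \<Rightarrow> complex"
  assumes "continuous_on UNIV g"
  shows "(\<lambda>t. g t * exp (- \<i> * of_int n * of_real t)) integrable_on {0..2*pi}"
  by (intro integrable_continuous_interval continuous_intros continuous_on_subset[OF assms]) auto

lemma fourier_coeff_diff:
  assumes "continuous_on UNIV g" "continuous_on UNIV h"
  shows "fourier_coeff (\<lambda>t. g t - h t) n = fourier_coeff g n - fourier_coeff h n"
  using integral_diff[OF assms[THEN integrable_fourier_integrand, of n]]
  by (simp add: fourier_coeff_def left_diff_distrib right_diff_distrib)

lemma A_alpha_fourier_coeff_summable:
  assumes "g \<in> A_alpha \<alpha>"
  shows "(\<lambda>n. norm (fourier_coeff g n)) summable_on UNIV"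
proof -
  have "((\<lambda>n. fourier_coeff g n * exp (\<i> * of_int n * of_real 0)) has_sum g 0) UNIV"
    using assms unfolding A_alpha_def by blast
  then have "fourier_coeff g summable_on UNIV"
    using has_sum_imp_summable by fastforce
  then show ?thesis
    by (simp only: summable_on_iff_abs_summable_on_complex)
qed

lemma A_alpha_Wp_summable:
  assumes "g \<in> A_alpha \<alpha>"
  shows "kc_summable (\<alpha> + 1) (\<lambda>k. Wp \<alpha> (fourier_coeff g) (int k))"
proof -
  have "(\<lambda>n. kc (\<alpha> + 1) (nat \<bar>n\<bar>) * norm (Wfrac \<alpha> (fourier_coeff g) n)) summable_on UNIV"
    using assms by (simp add: A_alpha_def)
  from summable_on_int_nonneg[OF this] show ?thesis
    by (simp add: Wfrac_def kc_summable_def)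
qed

lemma A_alpha_diff:
  assumes "0 < \<alpha>" and g: "g \<in> A_alpha \<alpha>" and h: "h \<in> A_alpha \<alpha>"
  shows "(\<lambda>t. g t - h t) \<in> A_alpha \<alpha>"
proof -
  let ?k = "\<lambda>n. kc (\<alpha> + 1) (nat \<bar>n\<bar>)"
  let ?G = "Wfrac \<alpha> (fourier_coeff g)" and ?H = "Wfrac \<alpha> (fourier_coeff h)"
  have coeff: "fourier_coeff (\<lambda>t. g t - h t) = (\<lambda>n. fourier_coeff g n - fourier_coeff h n)"
    using g h by (intro ext fourier_coeff_diff) (auto simp: A_alpha_def)
  have W: "Wfrac \<alpha> (fourier_coeff (\<lambda>t. g t - h t)) n = ?G n - ?H n" for n
    unfolding coeff using assms by (intro Wfrac_diff A_alpha_fourier_coeff_summable)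
  have "(\<lambda>n. ?k n * norm (?G n) + ?k n * norm (?H n)) summable_on UNIV"
    using g h by (intro summable_on_add) (auto simp: A_alpha_def)
  then have "(\<lambda>n. ?k n * norm (Wfrac \<alpha> (fourier_coeff (\<lambda>t. g t - h t)) n)) summable_on UNIV"
  proof (rule summable_on_comparison_test)
    show "?k n * norm (Wfrac \<alpha> (fourier_coeff (\<lambda>t. g t - h t)) n)
        \<le> ?k n * norm (?G n) + ?k n * norm (?H n)" for n
      unfolding W distrib_left[symmetric] using assms(1)
      by (intro mult_left_mono norm_triangle_ineq4 kc_nonneg) auto
  qed (use assms(1) in \<open>auto simp: kc_nonneg\<close>)
  moreover have "((\<lambda>n. fourier_coeff (\<lambda>t. g t - h t) n * exp (\<i> * of_int n * of_real t))
      has_sum (g t - h t)) UNIV" for t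
    using g h unfolding coeff left_diff_distrib by (intro has_sum_diff) (auto simp: A_alpha_def)
  ultimately show ?thesis
    using g h by (auto simp: A_alpha_def intro: continuous_on_diff)
qed

lemma l1_norm_fourier_coeff_le_A_norm:
  assumes "0 < \<alpha>" "g \<in> A_alpha \<alpha>"
  shows "(\<Sum>\<^sub>\<infinity>n. norm (fourier_coeff g n)) \<le> A_norm \<alpha> g"
  unfolding A_norm_def
  by (rule l1_norm_le_Wfrac[OF assms(1) A_alpha_fourier_coeff_summable[OF assms(2)]])
     (use assms(2) in \<open>simp add: A_alpha_def\<close>)

section \<open>Abel means and Poisson sums\<close>

definition abel_weight :: "real \<Rightarrow> int \<Rightarrow> real" where
  "abel_weight r j = r ^ nat \<bar>j\<bar>"

lemma abel_weight_nonneg [simp]: "0 \<le> r \<Longrightarrow> 0 \<le> abel_weight r j"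
  by (simp add: abel_weight_def)

lemma abel_weight_le_one: "0 \<le> r \<Longrightarrow> r \<le> 1 \<Longrightarrow> abel_weight r j \<le> 1"
  by (simp add: abel_weight_def power_le_one)

lemma abel_weight_summable:
  assumes "0 \<le> r" "r < 1"
  shows "abel_weight r summable_on UNIV"
proof -
  have geometric: "(\<lambda>k. r ^ k) summable_on UNIV"
    using assms by (intro summable_nonneg_imp_summable_on summable_geometric) auto
  have nonneg: "abel_weight r summable_on {0..}"
    by (rule iffD2[OF summable_on_reindex_bij_witness[where i = int and j = nat] geometric])
      (auto simp: abel_weight_def)
  have nonpos: "abel_weight r summable_on {..0}"
    by (rule iffD2[OF summable_on_reindex_bij_witness[where i = "\<lambda>n. - int n"
        and j = "\<lambda>j. nat (- j)"] geometric])
      (auto simp: abel_weight_def)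
  have "(UNIV :: int set) = {0..} \<union> {..0}"
    by auto
  then show ?thesis
    using summable_on_union[OF nonneg nonpos] by simp
qed

lemma abel_weight_recurrence:
  "(1 + r\<^sup>2) * abel_weight r j - r * abel_weight r (j - 1) - r * abel_weight r (j + 1)
    = (if j = 0 then 1 - r\<^sup>2 else 0)"
proof (cases j rule: int_cases3)
  case (pos n)
  then obtain k where "n = Suc k"
    by (cases n) auto
  moreover have "nat \<bar>int (Suc k) - 1\<bar> = k" "nat \<bar>int (Suc k)\<bar> = Suc k"
    "nat \<bar>int (Suc k) + 1\<bar> = Suc (Suc k)"
    by auto
  ultimately show ?thesis
    by (simp only: pos abel_weight_def) (simp add: power2_eq_square algebra_simps)
next
  case (neg n)
  then obtain k where "n = Suc k"
    by (cases n) auto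
  moreover have "nat \<bar>- int (Suc k) - 1\<bar> = Suc (Suc k)" "nat \<bar>- int (Suc k)\<bar> = Suc k"
    "nat \<bar>- int (Suc k) + 1\<bar> = k"
    by auto
  ultimately show ?thesis
    by (simp only: neg abel_weight_def) (simp add: power2_eq_square algebra_simps)
qed (simp add: power2_eq_square abel_weight_def)

definition abel_mean :: "real \<Rightarrow> (int \<Rightarrow> 'b::real_normed_vector) \<Rightarrow> int \<Rightarrow> 'b" where
  "abel_mean r f j = abel_weight r j *\<^sub>R f j"

lemma norm_abel_mean_le:
  assumes "0 \<le> r" "r \<le> 1"
  shows "norm (abel_mean r f j) \<le> norm (f j)"
  using assms by (simp add: abel_mean_def abel_weight_le_one mult_left_le_one_le)

lemma norm_diff_abel_mean_le:
  assumes "0 \<le> r" "r \<le> 1"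
  shows "norm (f j - abel_mean r f j) \<le> norm (f j)"
proof -
  have "f j - abel_mean r f j = (1 - abel_weight r j) *\<^sub>R f j"
    by (simp add: abel_mean_def scaleR_left_diff_distrib)
  then show ?thesis
    using assms by (simp add: abel_weight_le_one mult_left_le_one_le)
qed

lemma eventually_near_one:
  fixes c :: real
  assumes "0 < c"
  shows "\<forall>\<^sub>F r in at_left 1. 0 < r \<and> r < 1 \<and> 1 - r < c \<and> 1 / r - 1 < c"
proof (intro eventually_conj)
  have "((\<lambda>r::real. 1 - r) \<longlongrightarrow> 0) (at_left 1)" "((\<lambda>r::real. 1 / r - 1) \<longlongrightarrow> 0) (at_left 1)"
    by (auto intro!: tendsto_eq_intros)
  then show "\<forall>\<^sub>F r in at_left 1. 1 - r < c" "\<forall>\<^sub>F r in at_left 1. 1 / r - 1 < c"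
    using assms by (auto intro: order_tendstoD(2))
qed (use eventually_at_left_real[of 0 "1::real"] in \<open>auto elim: eventually_mono\<close>)

lemma abel_mean_l1_tendsto_0:
  fixes f :: "int \<Rightarrow> 'b::real_normed_vector"
  assumes f: "(\<lambda>j. norm (f j)) summable_on UNIV"
  shows "((\<lambda>r. \<Sum>\<^sub>\<infinity>j. norm (f j - abel_mean r f j)) \<longlongrightarrow> 0) (at_left 1)"
proof -
  have "((\<lambda>r. \<Sum>\<^sub>\<infinity>j. norm (f j - abel_mean r f j)) \<longlongrightarrow> (\<Sum>\<^sub>\<infinity>j::int. 0)) (at_left 1)"
  proof (rule tendsto_infsum_dominated[OF _ _ f])
    fix j
    have "((\<lambda>r. norm (f j - (r ^ nat \<bar>j\<bar>) *\<^sub>R f j)) \<longlongrightarrow> norm (f j - (1 ^ nat \<bar>j\<bar>) *\<^sub>R f j)) (at_left 1)"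
      by (intro tendsto_intros)
    then show "((\<lambda>r. norm (f j - abel_mean r f j)) \<longlongrightarrow> 0) (at_left 1)"
      by (simp add: abel_mean_def abel_weight_def)
  next
    show "\<forall>\<^sub>F r in at_left 1. \<forall>j\<in>UNIV. norm (norm (f j - abel_mean r f j)) \<le> norm (f j)"
      using eventually_near_one[OF zero_less_one]
      by eventually_elim (simp add: norm_diff_abel_mean_le)
  qed simp
  then show ?thesis by simp
qed

definition poisson_sum :: "real \<Rightarrow> (int \<Rightarrow> 'b::banach) \<Rightarrow> int \<Rightarrow> 'b" where
  "poisson_sum r x n = (\<Sum>\<^sub>\<infinity>j. abel_weight r j *\<^sub>R x (n + j))"

lemma
  fixes x :: "int \<Rightarrow> 'b::banach"
  assumes r: "0 \<le> r" "r < 1" and x: "\<And>k. norm (x k) \<le> C"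
  shows poisson_sum_has_sum: "((\<lambda>j. abel_weight r j *\<^sub>R x (n + j)) has_sum poisson_sum r x n) UNIV"
    and norm_poisson_sum_le: "norm (poisson_sum r x n) \<le> poisson_sum r (\<lambda>k. norm (x k)) n"
proof -
  have "(\<lambda>j. abel_weight r j * C) summable_on UNIV"
    by (intro summable_on_cmult_left abel_weight_summable r)
  then have summable: "(\<lambda>j. abel_weight r j * norm (x (n + j))) summable_on UNIV"
    by (rule summable_on_comparison_test) (use r x in \<open>auto intro: mult_left_mono\<close>)
  show "((\<lambda>j. abel_weight r j *\<^sub>R x (n + j)) has_sum poisson_sum r x n) UNIV"
    unfolding poisson_sum_def by (rule has_sum_infsum_dominated[OF summable]) (use r in simp)
  have "norm (poisson_sum r x n) \<le> (\<Sum>\<^sub>\<infinity>j. abel_weight r j * norm (x (n + j)))"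
    unfolding poisson_sum_def by (rule norm_infsum_le_dominated[OF summable]) (use r in simp)
  then show "norm (poisson_sum r x n) \<le> poisson_sum r (\<lambda>k. norm (x k)) n"
    by (simp add: poisson_sum_def)
qed

lemma poisson_sum_tendsto_0:
  fixes x :: "int \<Rightarrow> 'b::banach"
  assumes r: "0 \<le> r" "r < 1" and x: "\<And>k. norm (x k) \<le> C" "(x \<longlongrightarrow> 0) at_top"
  shows "(poisson_sum r x \<longlongrightarrow> 0) at_top"
proof -
  have "((\<lambda>n. \<Sum>\<^sub>\<infinity>j. abel_weight r j *\<^sub>R x (n + j)) \<longlongrightarrow> (\<Sum>\<^sub>\<infinity>j::int. 0)) at_top"
  proof (rule tendsto_infsum_dominated)
    fix j :: int
    have "filterlim (\<lambda>n. n + j) at_top at_top"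
      by (rule filterlim_at_top_at_top[where Q = "\<lambda>_. True" and P = "\<lambda>_. True"
          and g = "\<lambda>n. n - j"]) auto
    then show "((\<lambda>n. abel_weight r j *\<^sub>R x (n + j)) \<longlongrightarrow> 0) at_top"
      using tendsto_scaleR[OF tendsto_const filterlim_compose[OF x(2)]] by fastforce
  next
    show "\<forall>\<^sub>F n in at_top. \<forall>j\<in>UNIV. norm (abel_weight r j *\<^sub>R x (n + j)) \<le> abel_weight r j * C"
      using r x(1) by (simp add: mult_left_mono)
    show "(\<lambda>j::int. abel_weight r j * C) summable_on UNIV"
      by (intro summable_on_cmult_left abel_weight_summable r)
  qed simp
  then show ?thesis
    by (simp add: poisson_sum_def[abs_def])
qed

lemma poisson_sum_recurrence:
  fixes x :: "int \<Rightarrow> 'b::banach"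
  assumes "0 \<le> r" "r < 1" "\<And>k. norm (x k) \<le> C"
  shows "(1 + r\<^sup>2) *\<^sub>R poisson_sum r x n - r *\<^sub>R poisson_sum r x (n + 1) - r *\<^sub>R poisson_sum r x (n - 1)
    = (1 - r\<^sup>2) *\<^sub>R x n"
proof (rule has_sum_unique)
  let ?w = "abel_weight r"
  have shift: "((\<lambda>j. ?w (j - m) *\<^sub>R x (n + j)) has_sum poisson_sum r x (n + m)) UNIV" for m
    by (rule iffD1[OF has_sum_reindex_bij_witness[where i = "\<lambda>j. j - m" and j = "\<lambda>j. j + m"]
          poisson_sum_has_sum[OF assms]]) (auto simp: algebra_simps)
  have "((\<lambda>j. (1 + r\<^sup>2) *\<^sub>R ?w (j - 0) *\<^sub>R x (n + j)
        - r *\<^sub>R ?w (j - 1) *\<^sub>R x (n + j) - r *\<^sub>R ?w (j - - 1) *\<^sub>R x (n + j))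
      has_sum (1 + r\<^sup>2) *\<^sub>R poisson_sum r x (n + 0)
        - r *\<^sub>R poisson_sum r x (n + 1) - r *\<^sub>R poisson_sum r x (n + - 1)) UNIV"
    by (intro has_sum_diff has_sum_scaleR shift)
  then show "((\<lambda>j. ((1 + r\<^sup>2) * ?w j - r * ?w (j - 1) - r * ?w (j + 1)) *\<^sub>R x (n + j)) has_sum
      (1 + r\<^sup>2) *\<^sub>R poisson_sum r x n
        - r *\<^sub>R poisson_sum r x (n + 1) - r *\<^sub>R poisson_sum r x (n - 1)) UNIV"
    by (simp add: scaleR_left_diff_distrib)
  show "((\<lambda>j. ((1 + r\<^sup>2) * ?w j - r * ?w (j - 1) - r * ?w (j + 1)) *\<^sub>R x (n + j))
      has_sum (1 - r\<^sup>2) *\<^sub>R x n) UNIV"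
    unfolding abel_weight_recurrence by (rule has_sum_finite_neutralI[where B = "{0}"]) auto
qed

definition defect :: "('b::real_normed_vector \<Rightarrow> 'b) \<Rightarrow> (int \<Rightarrow> 'b) \<Rightarrow> int \<Rightarrow> 'b" where
  "defect L x k = L (x k) - x (k + 1)"

lemma norm_defect_le:
  assumes L: "bounded_linear L" and x: "\<And>k. norm (x k) \<le> C"
  shows "norm (defect L x k) \<le> onorm L * C + C"
proof -
  have "norm (L (x k)) \<le> onorm L * C"
    by (rule order_trans[OF onorm[OF L] mult_left_mono[OF x onorm_pos_le[OF L]]])
  then show ?thesis
    using norm_triangle_ineq4[of "L (x k)" "x (k + 1)"] x[of "k + 1"]
    unfolding defect_def by linarith
qed

lemma defect_poisson_sum:
  fixes L :: "'b::banach \<Rightarrow> 'b"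
  assumes L: "bounded_linear L" and r: "0 \<le> r" "r < 1" and x: "\<And>k. norm (x k) \<le> C"
  shows "defect L (poisson_sum r x) n = poisson_sum r (defect L x) n"
proof (rule has_sum_unique)
  have "((\<lambda>j. L (abel_weight r j *\<^sub>R x (n + j)) - abel_weight r j *\<^sub>R x (n + 1 + j)) has_sum
      L (poisson_sum r x n) - poisson_sum r x (n + 1)) UNIV"
    by (rule has_sum_diff[OF has_sum_bounded_linear[OF L]]; rule poisson_sum_has_sum[OF r x])
  then show "((\<lambda>j. abel_weight r j *\<^sub>R defect L x (n + j))
      has_sum defect L (poisson_sum r x) n) UNIV"
    by (simp add: defect_def bounded_linear.linear[OF L] linear_cmul
        scaleR_right_diff_distrib add_ac)
  show "((\<lambda>j. abel_weight r j *\<^sub>R defect L x (n + j)) has_sum poisson_sum r (defect L x) n) UNIV"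
    by (rule poisson_sum_has_sum[OF r norm_defect_le[OF L x]])
qed

text \<open>Up to the defect, \<open>L\<close> shifts the Poisson sums \<open>p\<close> of \<open>x\<close>, so that the recurrence
  factors as \<open>(r - L) (1 - r L) p = (r\<^sup>2 - 1) L x\<close>.\<close>
lemma poisson_sum_factorization:
  fixes L :: "'b::banach \<Rightarrow> 'b"
  assumes L: "bounded_linear L" and r: "0 \<le> r" "r < 1" and x: "\<And>k. norm (x k) \<le> C"
  defines "v \<equiv> \<lambda>n. poisson_sum r x n - r *\<^sub>R L (poisson_sum r x n)"
    and "\<epsilon> \<equiv> poisson_sum r (defect L x)"
  shows "r *\<^sub>R v n - L (v n) = r *\<^sub>R L (\<epsilon> n) - r *\<^sub>R \<epsilon> (n - 1) - (1 - r\<^sup>2) *\<^sub>R L (x n)"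
proof -
  interpret L: bounded_linear L by fact
  let ?p = "poisson_sum r x"
  have shift: "L (?p k) = ?p (k + 1) + \<epsilon> k" for k
    using defect_poisson_sum[OF L r x] by (simp add: \<epsilon>_def defect_def algebra_simps)
  have forward: "L (?p (n + 1)) = L (L (?p n)) - L (\<epsilon> n)"
    using shift[of n] by (simp add: L.add)
  have backward: "L (?p (n - 1)) = ?p n + \<epsilon> (n - 1)"
    using shift[of "n - 1"] by simp
  have "(1 + r\<^sup>2) *\<^sub>R L (?p n) - r *\<^sub>R L (?p (n + 1)) - r *\<^sub>R L (?p (n - 1)) = (1 - r\<^sup>2) *\<^sub>R L (x n)"
    using arg_cong[OF poisson_sum_recurrence[OF r x], of L] by (simp only: L.diff L.scaleR)
  then show ?thesis
    unfolding forward backward by (simp add: v_def L.diff L.scaleR algebra_simps power2_eq_square)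
qed

definition poisson_bound ::
  "('b::banach \<Rightarrow> 'b) \<Rightarrow> (int \<Rightarrow> 'b) \<Rightarrow> real \<Rightarrow> real \<Rightarrow> real \<Rightarrow> int \<Rightarrow> real" where
  "poisson_bound L x C K r n = (let \<eta> = poisson_sum r (\<lambda>k. norm (defect L x k)) in
    K * K / r * (r * (onorm L * \<eta> n) + r * \<eta> (n - 1) + (1 - r\<^sup>2) * (onorm L * C)))"

lemma poisson_bound_nonneg:
  assumes L: "bounded_linear L" and r: "0 < r" "r < 1" and x: "\<And>k. norm (x k) \<le> C"
  shows "0 \<le> poisson_bound L x C K r n"
proof -
  have "0 \<le> poisson_sum r (\<lambda>k. norm (defect L x k)) m" for m
    unfolding poisson_sum_def using r by (intro infsum_nonneg) simp
  moreover have "0 \<le> C"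
    using x[of 0] norm_ge_zero order_trans by blast
  ultimately show ?thesis
    unfolding poisson_bound_def Let_def using r onorm_pos_le[OF L]
    by (intro mult_nonneg_nonneg add_nonneg_nonneg divide_nonneg_nonneg zero_le_square)
      (auto simp: power_le_one)
qed

lemma poisson_bound_tendsto:
  assumes L: "bounded_linear L" and r: "0 < r" "r < 1" and x: "\<And>k. norm (x k) \<le> C"
    and defect: "(defect L x \<longlongrightarrow> 0) at_top"
  shows "(poisson_bound L x C K r \<longlongrightarrow> K * K / r * ((1 - r\<^sup>2) * (onorm L * C))) at_top"
proof -
  let ?\<eta> = "poisson_sum r (\<lambda>k. norm (defect L x k))"
  have \<eta>: "(?\<eta> \<longlongrightarrow> 0) at_top"
    using r norm_defect_le[OF L x] defect
    by (intro poisson_sum_tendsto_0[where C = "onorm L * C + C"] tendsto_norm_zero) auto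
  have "filterlim (\<lambda>n::int. n - 1) at_top at_top"
    by (rule filterlim_at_top_at_top[where Q = "\<lambda>_. True" and P = "\<lambda>_. True"
        and g = "\<lambda>n. n + 1"]) auto
  from filterlim_compose[OF \<eta> this] \<eta> show ?thesis
    unfolding poisson_bound_def[abs_def] Let_def using r(1) by (auto intro!: tendsto_eq_intros)
qed

lemma norm_poisson_sum_le_poisson_bound:
  fixes L :: "'b::banach \<Rightarrow> 'b"
  assumes L: "bounded_linear L" and r: "0 < r" "r < 1" and x: "\<And>k. norm (x k) \<le> C" and K: "0 < K"
    and inner: "\<And>v. norm v \<le> K * norm (r *\<^sub>R v - L v)"
    and outer: "\<And>v. norm v \<le> K * norm ((1 / r) *\<^sub>R v - L v)"
  shows "norm (poisson_sum r x n) \<le> poisson_bound L x C K r n"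
proof -
  have r': "0 \<le> r" and r2: "0 \<le> 1 - r\<^sup>2"
    using r by (auto simp: power_le_one)
  let ?p = "poisson_sum r x"
  define \<eta> where "\<eta> = poisson_sum r (\<lambda>k. norm (defect L x k))"
  define \<epsilon> where "\<epsilon> = poisson_sum r (defect L x)"
  define v where "v = ?p n - r *\<^sub>R L (?p n)"
  define B where "B = r * (onorm L * \<eta> n) + r * \<eta> (n - 1) + (1 - r\<^sup>2) * (onorm L * C)"
  have \<epsilon>: "norm (\<epsilon> k) \<le> \<eta> k" for k
    unfolding \<epsilon>_def \<eta>_def by (rule norm_poisson_sum_le[OF r' r(2) norm_defect_le[OF L x]])
  have norm_L: "norm (L y) \<le> onorm L * c" if "norm y \<le> c" for y c
    using order_trans[OF onorm[OF L] mult_left_mono[OF that onorm_pos_le[OF L]]] .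
  have "norm (r *\<^sub>R v - L v) = norm (r *\<^sub>R L (\<epsilon> n) - r *\<^sub>R \<epsilon> (n - 1) - (1 - r\<^sup>2) *\<^sub>R L (x n))"
    unfolding v_def \<epsilon>_def using poisson_sum_factorization[OF L r' r(2) x] by simp
  also have "\<dots> \<le> r * norm (L (\<epsilon> n)) + r * norm (\<epsilon> (n - 1)) + (1 - r\<^sup>2) * norm (L (x n))"
    using r r2 by (intro norm_triangle_le_diff add_mono) auto
  also have "\<dots> \<le> B"
    unfolding B_def using r' r2 by (intro add_mono mult_left_mono norm_L \<epsilon> x) auto
  finally have factor: "norm (r *\<^sub>R v - L v) \<le> B" .
  have "(1 / r) *\<^sub>R ?p n - L (?p n) = (1 / r) *\<^sub>R v"
    using r by (simp add: v_def scaleR_right_diff_distrib)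
  then have "norm (?p n) \<le> K / r * norm v"
    using outer[of "?p n"] r by simp
  also have "\<dots> \<le> K / r * (K * norm (r *\<^sub>R v - L v))"
    using K r by (intro mult_left_mono inner) auto
  also have "\<dots> \<le> K / r * (K * B)"
    using K r factor by (intro mult_left_mono) auto
  also have "\<dots> = poisson_bound L x C K r n"
    by (simp add: poisson_bound_def Let_def B_def \<eta>_def)
  finally show ?thesis .
qed

section \<open>Complex scalars and the approximate point spectrum\<close>

locale complex_banach =
  fixes scale :: "complex \<Rightarrow> 'b::banach \<Rightarrow> 'b" (infixr \<open>*\<^sub>C\<close> 75)
  assumes scale_add_left: "(a + b) *\<^sub>C v = a *\<^sub>C v + b *\<^sub>C v"
    and scale_add_right: "a *\<^sub>C (v + w) = a *\<^sub>C v + a *\<^sub>C w"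
    and scale_scale: "a *\<^sub>C b *\<^sub>C v = (a * b) *\<^sub>C v"
    and scale_of_real: "of_real r *\<^sub>C v = r *\<^sub>R v"
    and norm_scale: "norm (a *\<^sub>C v) = norm a * norm v"
begin

sublocale scale: bounded_bilinear "(*\<^sub>C)"
proof
  show "(r *\<^sub>R a) *\<^sub>C v = r *\<^sub>R (a *\<^sub>C v)" for r a v
    by (simp add: scale_scale scaleR_conv_of_real flip: scale_of_real)
  show "a *\<^sub>C (r *\<^sub>R v) = r *\<^sub>R (a *\<^sub>C v)" for r a v
    by (simp add: scale_scale mult.commute flip: scale_of_real)
  show "\<exists>K. \<forall>a v. norm (a *\<^sub>C v) \<le> norm a * norm v * K"
    by (intro exI[of _ 1]) (simp add: norm_scale)
qed (simp_all add: scale_add_left scale_add_right)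

definition resolvent_bound :: "real \<Rightarrow> ('b \<Rightarrow> 'b) \<Rightarrow> complex \<Rightarrow> bool" where
  "resolvent_bound K L z \<longleftrightarrow> 0 < K \<and> (\<forall>v. norm v \<le> K * norm (z *\<^sub>C v - L v))"

definition approx_spectrum :: "('b \<Rightarrow> 'b) \<Rightarrow> complex set" where
  "approx_spectrum L = {z. \<nexists>K. resolvent_bound K L z}"

lemma resolvent_bound_mono:
  assumes "resolvent_bound K L z" "K \<le> K'"
  shows "resolvent_bound K' L z"
  using assms mult_right_mono[OF assms(2) norm_ge_zero]
  unfolding resolvent_bound_def by (meson less_le_trans order_trans)

lemma resolvent_bound_perturb:
  assumes K: "resolvent_bound K L z" and dist: "dist z w \<le> 1 / (2 * K)"
  shows "resolvent_bound (2 * K) L w"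
  unfolding resolvent_bound_def
proof (intro conjI allI)
  show K_pos: "0 < 2 * K"
    using K by (simp add: resolvent_bound_def)
  fix v
  have "norm v \<le> K * norm (z *\<^sub>C v - L v)"
    using K by (simp add: resolvent_bound_def)
  also have "z *\<^sub>C v - L v = (w *\<^sub>C v - L v) + (z - w) *\<^sub>C v"
    by (simp add: scale.diff_left)
  also have "norm \<dots> \<le> norm (w *\<^sub>C v - L v) + 1 / (2 * K) * norm v"
    using mult_right_mono[OF dist norm_ge_zero[of v]]
    by (intro norm_triangle_mono) (simp_all add: norm_scale dist_norm)
  finally show "norm v \<le> 2 * K * norm (w *\<^sub>C v - L v)"
    using K_pos by (simp add: algebra_simps)
qed

lemma resolvent_bound_compact:
  assumes Z: "compact Z" and disjoint: "Z \<inter> approx_spectrum L = {}"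
  obtains K where "0 < K" "\<And>z. z \<in> Z \<Longrightarrow> resolvent_bound K L z"
proof -
  have "\<forall>z\<in>Z. \<exists>K. resolvent_bound K L z"
    using disjoint by (auto simp: approx_spectrum_def)
  then obtain N where N: "\<And>z. z \<in> Z \<Longrightarrow> resolvent_bound (N z) L z"
    by metis
  then have N_pos: "0 < N z" if "z \<in> Z" for z
    using that by (simp add: resolvent_bound_def)
  obtain D where D: "D \<subseteq> Z" "finite D" "Z \<subseteq> (\<Union>z\<in>D. ball z (1 / (2 * N z)))"
  proof (rule compactE_image[OF Z, where C = Z and f = "\<lambda>z. ball z (1 / (2 * N z))"])
    show "Z \<subseteq> (\<Union>z\<in>Z. ball z (1 / (2 * N z)))"
      using N_pos by force
  qed auto
  have N_nonneg: "0 \<le> 2 * N z" if "z \<in> D" for z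
    using N_pos D(1) that by (auto intro: less_imp_le)
  define K where "K = 1 + (\<Sum>z\<in>D. 2 * N z)"
  show ?thesis
  proof (rule that[of K])
    show "0 < K"
      unfolding K_def using N_nonneg by (intro add_pos_nonneg sum_nonneg) auto
    fix w assume "w \<in> Z"
    then obtain z where z: "z \<in> D" "dist z w < 1 / (2 * N z)"
      using D(3) by auto
    have "resolvent_bound (2 * N z) L w"
      using N D(1) z by (intro resolvent_bound_perturb[of _ _ z]) auto
    moreover have "2 * N z \<le> K"
      unfolding K_def using member_le_sum[OF z(1) _ D(2), of "\<lambda>z. 2 * N z"] N_nonneg by auto
    ultimately show "resolvent_bound K L w"
      by (rule resolvent_bound_mono)
  qed
qed

section \<open>Correlation with summable coefficients\<close>

definition correlation :: "(int \<Rightarrow> complex) \<Rightarrow> (int \<Rightarrow> 'b) \<Rightarrow> int \<Rightarrow> 'b" where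
  "correlation f x n = (\<Sum>\<^sub>\<infinity>j. f j *\<^sub>C x (n + j))"

lemma
  assumes f: "(\<lambda>j. norm (f j)) summable_on UNIV" and x: "\<And>k. norm (x k) \<le> C"
  shows correlation_has_sum: "((\<lambda>j. f j *\<^sub>C x (n + j)) has_sum correlation f x n) UNIV"
    and norm_correlation_le: "norm (correlation f x n) \<le> (\<Sum>\<^sub>\<infinity>j. norm (f j)) * C"
proof -
  have summable: "(\<lambda>j. norm (f j) * C) summable_on UNIV"
    by (rule summable_on_cmult_left[OF f])
  have term_le: "norm (f j *\<^sub>C x (n + j)) \<le> norm (f j) * C" for j
    using x by (simp add: norm_scale mult_left_mono)
  show "((\<lambda>j. f j *\<^sub>C x (n + j)) has_sum correlation f x n) UNIV"
    unfolding correlation_def by (rule has_sum_infsum_dominated[OF summable term_le])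
  have "norm (correlation f x n) \<le> (\<Sum>\<^sub>\<infinity>j. norm (f j) * C)"
    unfolding correlation_def by (rule norm_infsum_le_dominated[OF summable term_le])
  then show "norm (correlation f x n) \<le> (\<Sum>\<^sub>\<infinity>j. norm (f j)) * C"
    by (simp add: infsum_cmult_left')
qed

lemma norm_correlation_diff_le:
  assumes f: "(\<lambda>j. norm (f j)) summable_on UNIV" and g: "(\<lambda>j. norm (g j)) summable_on UNIV"
    and x: "\<And>k. norm (x k) \<le> C"
  shows "norm (correlation f x n - correlation g x n) \<le> (\<Sum>\<^sub>\<infinity>j. norm (f j - g j)) * C"
proof -
  have "((\<lambda>j. f j *\<^sub>C x (n + j) - g j *\<^sub>C x (n + j))
      has_sum correlation f x n - correlation g x n) UNIV"
    by (rule has_sum_diff[OF correlation_has_sum[OF f x] correlation_has_sum[OF g x]])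
  then have "correlation f x n - correlation g x n = correlation (\<lambda>j. f j - g j) x n"
    unfolding correlation_def[of "\<lambda>j. f j - g j"] by (simp add: scale.diff_left infsumI)
  moreover have "(\<lambda>j. norm (f j - g j)) summable_on UNIV"
    by (rule summable_on_comparison_test[OF summable_on_add[OF f g]])
      (auto intro: norm_triangle_ineq4)
  ultimately show ?thesis
    using norm_correlation_le x by simp
qed

definition modulate :: "real \<Rightarrow> (int \<Rightarrow> 'b) \<Rightarrow> int \<Rightarrow> 'b" where
  "modulate t x k = cis (- (of_int k * t)) *\<^sub>C x k"

lemma norm_modulate [simp]: "norm (modulate t x k) = norm (x k)"
  by (simp add: modulate_def norm_scale)

lemma poisson_sum_modulate_has_sum:
  assumes r: "0 \<le> r" "r < 1" and x: "\<And>k. norm (x k) \<le> C"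
  shows "((\<lambda>j. (c * exp (- \<i> * of_int j * of_real t)) *\<^sub>C (abel_weight r j *\<^sub>R x (n + j)))
    has_sum (c * cis (of_int n * t)) *\<^sub>C poisson_sum r (modulate t x) n) UNIV"
proof -
  have "((\<lambda>j. abel_weight r j *\<^sub>R modulate t x (n + j)) has_sum poisson_sum r (modulate t x) n) UNIV"
    by (rule poisson_sum_has_sum[OF r, where C = C]) (simp add: x)
  from has_sum_bounded_linear[OF scale.bounded_linear_right this, of "c * cis (of_int n * t)"]
  show ?thesis
    unfolding modulate_def
    by (simp add: scale.scaleR_right scale_scale cis_conv_exp algebra_simps flip: exp_add)
qed

lemma abel_correlation_has_integral:
  assumes h: "continuous_on UNIV h" and r: "0 \<le> r" "r < 1" and x: "\<And>k. norm (x k) \<le> C"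
  shows "((\<lambda>t. (h t * cis (of_int n * t)) *\<^sub>C poisson_sum r (modulate t x) n) has_integral
    (2 * pi) *\<^sub>R correlation (abel_mean r (fourier_coeff h)) x n) {0..2*pi}"
proof -
  define f where
    "f j t = (h t * exp (- \<i> * of_int j * of_real t)) *\<^sub>C (abel_weight r j *\<^sub>R x (n + j))" for j t
  have sum: "(\<Sum>\<^sub>\<infinity>j. f j t) = (h t * cis (of_int n * t)) *\<^sub>C poisson_sum r (modulate t x) n" for t
    unfolding f_def by (rule infsumI[OF poisson_sum_modulate_has_sum[OF r x]])
  obtain H where H: "\<And>t. t \<in> {0..2*pi} \<Longrightarrow> norm (h t) \<le> H"
    using continuous_on_interval_norm_bounded[OF continuous_on_subset[OF h]] by blast
  have "((\<lambda>t. \<Sum>\<^sub>\<infinity>j. f j t) has_integral (\<Sum>\<^sub>\<infinity>j. integral {0..2*pi} (f j))) {0..2*pi}"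
  proof (rule has_integral_infsum)
    show "continuous_on {0..2*pi} (f j)" for j
      unfolding f_def
      by (intro scale.continuous_on continuous_intros continuous_on_subset[OF h]) auto
    show "norm (f j t) \<le> H * (abel_weight r j * C)" if "t \<in> {0..2*pi}" for j t
      using r H[OF that] order_trans[OF norm_ge_zero H[OF that]] x
      by (auto simp: f_def norm_scale norm_mult intro!: mult_mono mult_left_mono)
    show "(\<lambda>j. H * (abel_weight r j * C)) summable_on UNIV"
      by (intro summable_on_cmult_left summable_on_cmult_right abel_weight_summable r)
  qed
  moreover have "integral {0..2*pi} (f j)
      = (2 * pi) *\<^sub>R (abel_mean r (fourier_coeff h) j *\<^sub>C x (n + j))" for j
    using integral_linear[OF integrable_fourier_integrand[OF h, of j]
        scale.bounded_linear_left[of "abel_weight r j *\<^sub>R x (n + j)"]]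
    by (simp add: f_def[abs_def] o_def abel_mean_def scaleR_conv_of_real[of _ "_ :: complex"]
        fourier_coeff_def scale_scale mult_ac flip: scale_of_real)
  ultimately show ?thesis
    by (simp add: sum infsum_scaleR_right correlation_def)
qed

lemma norm_abel_correlation_le:
  assumes h: "continuous_on UNIV h" and r: "0 \<le> r" "r < 1" and x: "\<And>k. norm (x k) \<le> C"
    and bound: "\<And>t. t \<in> {0..2*pi} \<Longrightarrow> norm (h t) * norm (poisson_sum r (modulate t x) n) \<le> B"
  shows "norm (correlation (abel_mean r (fourier_coeff h)) x n) \<le> B"
proof -
  let ?c = "correlation (abel_mean r (fourier_coeff h)) x n"
  have B_nonneg: "0 \<le> B"
    using bound[of 0] by (rule order_trans[rotated]) auto
  have "norm ((2 * pi) *\<^sub>R ?c) \<le> B * measure lborel {0..2*pi}"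
    by (rule has_integral_bound_real[where S = "{}",
          OF B_nonneg _ abel_correlation_has_integral[OF h r x]])
       (use bound in \<open>auto simp: norm_scale norm_mult\<close>)
  then show ?thesis
    by (simp add: mult.commute)
qed

end

section \<open>Asymptotic orbits\<close>

definition vanishes_near :: "real set \<Rightarrow> (real \<Rightarrow> complex) \<Rightarrow> bool" where
  "vanishes_near E h \<longleftrightarrow> (\<exists>U. open U \<and> E \<subseteq> U \<and> (\<forall>t\<in>U. h t = 0))"

locale asymptotic_orbit = complex_banach scale
  for scale :: "complex \<Rightarrow> 'b::banach \<Rightarrow> 'b" (infixr \<open>*\<^sub>C\<close> 75) +
  fixes L :: "'b \<Rightarrow> 'b" and x :: "int \<Rightarrow> 'b" and C :: real
  assumes bounded_linear: "bounded_linear L"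
    and linear_scale: "L (a *\<^sub>C v) = a *\<^sub>C L v"
    and norm_orbit_le: "norm (x k) \<le> C"
    and defect_tendsto_0: "(defect L x \<longlongrightarrow> 0) at_top"
begin

lemma norm_poisson_sum_modulate_le:
  assumes r: "0 < r" "r < 1"
    and inner: "resolvent_bound K L (of_real r * cis t)"
    and outer: "resolvent_bound K L (of_real (1 / r) * cis t)"
  shows "norm (poisson_sum r (modulate t x) n) \<le> poisson_bound L x C K r n"
proof -
  define M where "M v = cis (- t) *\<^sub>C L v" for v
  have M: "bounded_linear M"
    unfolding M_def
    by (rule bounded_linear_compose[OF scale.bounded_linear_right bounded_linear])
  have onorm: "onorm M = onorm L"
    by (simp add: onorm_def M_def norm_scale)
  have "defect M (modulate t x) k = cis (- (of_int (k + 1) * t)) *\<^sub>C defect L x k" for k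
    by (simp add: defect_def M_def modulate_def linear_scale scale_scale scale.diff_right cis_mult
        algebra_simps)
  then have defect: "norm (defect M (modulate t x) k) = norm (defect L x k)" for k
    by (simp add: norm_scale)
  have norm: "norm (s *\<^sub>R v - M v) = norm ((of_real s * cis t) *\<^sub>C v - L v)" for s v
  proof -
    have "s *\<^sub>R v - M v = cis (- t) *\<^sub>C ((of_real s * cis t) *\<^sub>C v - L v)"
      by (simp add: M_def scale.diff_right scale_scale mult.left_commute cis_mult
          flip: scale_of_real)
    then show ?thesis by (simp add: norm_scale)
  qed
  have "0 < K" "\<And>v. norm v \<le> K * norm (r *\<^sub>R v - M v)" "\<And>v. norm v \<le> K * norm ((1 / r) *\<^sub>R v - M v)"
    unfolding norm using inner outer by (auto simp: resolvent_bound_def)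
  then show ?thesis
    using norm_poisson_sum_le_poisson_bound[OF M r, of "modulate t x" C K n] norm_orbit_le
    by (simp add: poisson_bound_def onorm defect)
qed

lemma norm_abel_correlation_le_poisson_bound:
  assumes h: "continuous_on UNIV h" and H: "\<And>t. t \<in> {0..2*pi} \<Longrightarrow> norm (h t) \<le> H"
    and K: "0 < K" "\<And>t. t \<in> {0..2*pi} \<Longrightarrow> h t \<noteq> 0 \<Longrightarrow> resolvent_bound K L (cis t)"
    and r: "0 < r" "r < 1" "1 - r \<le> 1 / (2 * K)" "1 / r - 1 \<le> 1 / (2 * K)"
  shows "norm (correlation (abel_mean r (fourier_coeff h)) x n)
    \<le> H * poisson_bound L x C (2 * K) r n"
proof (rule norm_abel_correlation_le[OF h _ r(2) norm_orbit_le])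
  have poisson: "norm (poisson_sum r (modulate t x) n) \<le> poisson_bound L x C (2 * K) r n"
    if t: "t \<in> {0..2*pi}" "h t \<noteq> 0" for t
  proof -
    have "resolvent_bound (2 * K) L (of_real s * cis t)" if "\<bar>1 - s\<bar> \<le> 1 / (2 * K)" for s
    proof (rule resolvent_bound_perturb[OF K(2)[OF t]])
      have "cis t - of_real s * cis t = of_real (1 - s) * cis t"
        by (simp add: algebra_simps)
      then show "dist (cis t) (of_real s * cis t) \<le> 1 / (2 * K)"
        using that unfolding dist_norm by (simp only: norm_mult norm_of_real) simp
    qed
    from this[of r] this[of "1 / r"] show ?thesis
      using r by (intro norm_poisson_sum_modulate_le) auto
  qed
  show "norm (h t) * norm (poisson_sum r (modulate t x) n) \<le> H * poisson_bound L x C (2 * K) r n"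
      if t: "t \<in> {0..2*pi}" for t
  proof (cases "h t = 0")
    case True
    then show ?thesis
      using H[OF t] poisson_bound_nonneg[OF bounded_linear r(1,2) norm_orbit_le] by simp
  next
    case False
    then show ?thesis
      using H[OF t] poisson[OF t] by (intro mult_mono) (auto intro: order_trans[OF norm_ge_zero])
  qed
qed (use r in auto)

lemma resolvent_bound_on_support:
  assumes "vanishes_near {t. cis t \<in> approx_spectrum L} h"
  obtains K where "0 < K" "\<And>t. t \<in> {a..b} \<Longrightarrow> h t \<noteq> 0 \<Longrightarrow> resolvent_bound K L (cis t)"
proof -
  obtain U where U: "open U" "{t. cis t \<in> approx_spectrum L} \<subseteq> U" and h0: "\<And>t. t \<in> U \<Longrightarrow> h t = 0"
    using assms by (auto simp: vanishes_near_def)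
  let ?Z = "cis ` ({a..b} - U)"
  have "compact ?Z"
    by (intro compact_continuous_image continuous_intros compact_diff U) auto
  moreover have "?Z \<inter> approx_spectrum L = {}"
    using U(2) by auto
  ultimately obtain K where K: "0 < K" "\<And>z. z \<in> ?Z \<Longrightarrow> resolvent_bound K L z"
    by (rule resolvent_bound_compact) blast
  show ?thesis
    by (rule that[OF K(1)]) (use K(2) h0 in blast)
qed

lemma norm_correlation_le_abel_mean:
  assumes f: "(\<lambda>j. norm (f j)) summable_on UNIV" and r: "0 < r" "r < 1"
  shows "norm (correlation f x n)
    \<le> norm (correlation (abel_mean r f) x n) + (\<Sum>\<^sub>\<infinity>j. norm (f j - abel_mean r f j)) * C"
proof -
  have "(\<lambda>j. norm (abel_mean r f j)) summable_on UNIV"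
    by (rule summable_on_comparison_test[OF f]) (use r in \<open>auto intro: norm_abel_mean_le\<close>)
  from norm_correlation_diff_le[OF f this norm_orbit_le] show ?thesis
    by (intro order_trans[OF norm_triangle_sub add_left_mono])
qed

theorem correlation_fourier_tendsto_0:
  assumes h: "continuous_on UNIV h" and f: "(\<lambda>j. norm (fourier_coeff h j)) summable_on UNIV"
    and "vanishes_near {t. cis t \<in> approx_spectrum L} h"
  shows "(correlation (fourier_coeff h) x \<longlongrightarrow> 0) at_top"
proof -
  obtain K where K: "0 < K" "\<And>t. t \<in> {0..2*pi} \<Longrightarrow> h t \<noteq> 0 \<Longrightarrow> resolvent_bound K L (cis t)"
    using assms(3) by (rule resolvent_bound_on_support) blast
  obtain H where H: "\<And>t. t \<in> {0..2*pi} \<Longrightarrow> norm (h t) \<le> H"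
    using continuous_on_interval_norm_bounded[OF continuous_on_subset[OF h]] by blast
  define \<rho> where "\<rho> r = (\<Sum>\<^sub>\<infinity>j. norm (fourier_coeff h j - abel_mean r (fourier_coeff h) j))" for r
  define b where "b r n = H * poisson_bound L x C (2 * K) r n + \<rho> r * C" for r n
  define l where "l r = H * (2 * K * (2 * K) / r * ((1 - r\<^sup>2) * (onorm L * C))) + \<rho> r * C" for r
  have near_1: "\<forall>\<^sub>F r in at_left 1. 0 < r \<and> r < 1 \<and> 1 - r < 1 / (2 * K) \<and> 1 / r - 1 < 1 / (2 * K)"
    using K(1) by (intro eventually_near_one) simp
  show ?thesis
  proof (rule tendsto_0_by_approximation)
    from near_1 show "\<forall>\<^sub>F r in at_left 1. \<forall>n. norm (correlation (fourier_coeff h) x n) \<le> b r n"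
    proof eventually_elim
      case (elim r)
      have "norm (correlation (abel_mean r (fourier_coeff h)) x n)
          \<le> H * poisson_bound L x C (2 * K) r n" for n
        using K elim by (intro norm_abel_correlation_le_poisson_bound h H) auto
      with elim show ?case
        unfolding b_def \<rho>_def
        by (intro allI order_trans[OF norm_correlation_le_abel_mean[OF f] add_right_mono]) auto
    qed
    show "\<forall>\<^sub>F r in at_left 1. (b r \<longlongrightarrow> l r) at_top"
      using near_1 unfolding b_def[abs_def] l_def
      by eventually_elim (intro tendsto_add tendsto_mult tendsto_const
        poisson_bound_tendsto bounded_linear norm_orbit_le defect_tendsto_0; blast)
    have "(\<rho> \<longlongrightarrow> 0) (at_left 1)"
      unfolding \<rho>_def[abs_def] by (rule abel_mean_l1_tendsto_0[OF f])
    then show "(l \<longlongrightarrow> 0) (at_left 1)"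
      unfolding l_def[abs_def] by (auto intro!: tendsto_eq_intros)
  qed simp
qed

end

section \<open>Cesaro means\<close>

interpretation blinfun_compose: bounded_bilinear "(o\<^sub>L)"
  by (rule bounded_bilinear_blinfun_compose)

lemmas blinfun_compose_linear =
  blinfun_compose.add_left blinfun_compose.add_right
  blinfun_compose.diff_left blinfun_compose.diff_right
  blinfun_compose.minus_left blinfun_compose.minus_right
  blinfun_compose.scaleR_left blinfun_compose.scaleR_right
  blinfun_compose.sum_left blinfun_compose.sum_right

lemma blinfun_compose_assoc: "(A o\<^sub>L B) o\<^sub>L D = A o\<^sub>L (B o\<^sub>L D)"
  by (rule blinfun_eqI) simp

lemma blinfun_compose_id [simp]: "A o\<^sub>L id_blinfun = A" "id_blinfun o\<^sub>L A = A"
  by (rule blinfun_eqI; simp)+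

lemma opow_0 [simp]: "opow T 0 = id_blinfun"
  by (simp add: opow_def)

lemma opow_Suc: "opow T (Suc j) = T o\<^sub>L opow T j"
  by (simp add: opow_def)

lemma opow_commute:
  assumes "T o\<^sub>L A = A o\<^sub>L T"
  shows "opow T j o\<^sub>L A = A o\<^sub>L opow T j"
proof (induction j)
  case (Suc j)
  have "opow T (Suc j) o\<^sub>L A = (T o\<^sub>L A) o\<^sub>L opow T j"
    by (simp add: opow_Suc blinfun_compose_assoc Suc)
  then show ?case
    by (simp add: assms opow_Suc blinfun_compose_assoc)
qed simp

lemma cesaro_mean_commute:
  assumes "T o\<^sub>L A = A o\<^sub>L T"
  shows "cesaro_mean \<alpha> T n o\<^sub>L A = A o\<^sub>L cesaro_mean \<alpha> T n"
  by (simp add: cesaro_mean_def cesaro_sum_def blinfun_compose_linear opow_commute[OF assms])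

lemma cesaro_sum_Suc:
  "cesaro_sum \<alpha> T (Suc n) = (T o\<^sub>L cesaro_sum \<alpha> T n) + kc \<alpha> (Suc n) *\<^sub>R id_blinfun"
  unfolding cesaro_sum_def sum.atMost_Suc_shift by (simp add: opow_Suc blinfun_compose_linear)

lemma cesaro_sum_eq_mean:
  assumes "0 < \<alpha>"
  shows "cesaro_sum \<alpha> T n = kc (\<alpha> + 1) n *\<^sub>R cesaro_mean \<alpha> T n"
  using assms kc_pos[of "\<alpha> + 1" n] by (simp add: cesaro_mean_def)

lemma cesaro_mean_shift:
  assumes "0 < \<alpha>"
  shows "(T o\<^sub>L cesaro_mean \<alpha> T n) - cesaro_mean \<alpha> T (Suc n)
    = (\<alpha> / (\<alpha> + Suc n)) *\<^sub>R ((T o\<^sub>L cesaro_mean \<alpha> T n) - id_blinfun)"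
proof -
  define A where "A = T o\<^sub>L cesaro_mean \<alpha> T n"
  have ratio: "kc (\<alpha> + 1) n / kc (\<alpha> + 1) (Suc n) = 1 - \<alpha> / (\<alpha> + Suc n)"
    using assms kc_pos[of "\<alpha> + 1" n] by (simp add: kc_Suc divide_simps)
  have "cesaro_mean \<alpha> T (Suc n) = (kc (\<alpha> + 1) n / kc (\<alpha> + 1) (Suc n)) *\<^sub>R A
      + (kc \<alpha> (Suc n) / kc (\<alpha> + 1) (Suc n)) *\<^sub>R id_blinfun"
    by (simp add: cesaro_mean_def[of \<alpha> T "Suc n"] cesaro_sum_Suc cesaro_sum_eq_mean[OF assms] A_def
        blinfun_compose_linear scaleR_right_distrib)
  also have "\<dots> = (1 - \<alpha> / (\<alpha> + Suc n)) *\<^sub>R A + (\<alpha> / (\<alpha> + Suc n)) *\<^sub>R id_blinfun"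
    by (simp only: ratio kc_ratio_add_one[OF assms])
  finally show ?thesis
    unfolding A_def[symmetric] by (simp add: algebra_simps)
qed

lemma cesaro_mean_shift_tendsto_0:
  assumes "0 < \<alpha>" and M: "\<And>n. norm (cesaro_mean \<alpha> T n) \<le> C"
  shows "(\<lambda>n. (T o\<^sub>L cesaro_mean \<alpha> T n) - cesaro_mean \<alpha> T (Suc n)) \<longlonglongrightarrow> 0"
proof (rule Lim_null_comparison)
  have "norm ((T o\<^sub>L cesaro_mean \<alpha> T n) - id_blinfun) \<le> norm T * C + 1" for n
    by (intro norm_triangle_le_diff add_mono order_trans[OF norm_blinfun_compose] mult_left_mono M
        norm_blinfun_id_le norm_ge_zero)
  then show "\<forall>\<^sub>F n in sequentially. norm ((T o\<^sub>L cesaro_mean \<alpha> T n) - cesaro_mean \<alpha> T (Suc n))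
      \<le> \<alpha> / (\<alpha> + Suc n) * (norm T * C + 1)"
    using assms(1) by (intro always_eventually allI)
      (simp add: cesaro_mean_shift mult_left_mono divide_right_mono)
  have "(\<lambda>n. \<alpha> / (\<alpha> + n)) \<longlonglongrightarrow> 0"
    by (intro tendsto_divide_0[OF tendsto_const] filterlim_at_top_imp_at_infinity
        filterlim_tendsto_add_at_top[OF tendsto_const] filterlim_real_sequentially)
  then show "(\<lambda>n. \<alpha> / (\<alpha> + Suc n) * (norm T * C + 1)) \<longlonglongrightarrow> 0"
    by (rule tendsto_mult_left_zero[OF LIMSEQ_Suc])
qed

lemma complex_banach_cscaleL:
  assumes "complex_structure J"
  shows "complex_banach (cscaleL J)"
proof
  have JJ: "J o\<^sub>L J = - id_blinfun"
    using assms by (simp add: complex_structure_def)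
  fix a b :: complex and r :: real and A B :: "'a \<Rightarrow>\<^sub>L 'a"
  show "cscaleL J (a + b) A = cscaleL J a A + cscaleL J b A"
    "cscaleL J a (A + B) = cscaleL J a A + cscaleL J a B"
    "cscaleL J (of_real r) A = r *\<^sub>R A"
    by (simp_all add: cscaleL_def blinfun_compose_linear algebra_simps)
  have "J o\<^sub>L (J o\<^sub>L A) = - A"
    by (simp add: blinfun_compose_assoc[symmetric] JJ blinfun_compose_linear)
  then show "cscaleL J a (cscaleL J b A) = cscaleL J (a * b) A"
    by (simp add: cscaleL_def blinfun_compose_linear algebra_simps)
  have "norm (cscaleL J a A v) = norm ((norm a *\<^sub>R A) v)" for v
  proof -
    have "Re a = norm a * cos (Arg a)" "Im a = norm a * sin (Arg a)"
      by (metis Re_rcis rcis_cmod_Arg, metis Im_rcis rcis_cmod_Arg)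
    then have "cscaleL J a A v = norm a *\<^sub>R (cos (Arg a) *\<^sub>R A v + sin (Arg a) *\<^sub>R J (A v))"
      by (simp add: cscaleL_def blinfun.add_left blinfun.scaleR_left scaleR_right_distrib)
    then show ?thesis
      using assms by (simp add: complex_structure_def blinfun.scaleR_left)
  qed
  then have "norm (cscaleL J a A) = norm (norm a *\<^sub>R A)"
    by (simp only: norm_blinfun.rep_eq onorm_def)
  then show "norm (cscaleL J a A) = norm a * norm A"
    by simp
qed

lemma cscaleL_compose: "cscaleL J z A o\<^sub>L B = cscaleL J z (A o\<^sub>L B)"
  by (simp add: cscaleL_def blinfun_compose_linear blinfun_compose_assoc)

lemma compose_cscaleL:
  assumes "A o\<^sub>L J = J o\<^sub>L A"
  shows "A o\<^sub>L cscaleL J z B = cscaleL J z (A o\<^sub>L B)"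
  by (simp add: cscaleL_def blinfun_compose_linear blinfun_compose_assoc[symmetric] assms)

locale cesaro_bounded_op =
  fixes J T :: "'a::banach \<Rightarrow>\<^sub>L 'a" and \<alpha> C :: real
  assumes complex_structure: "complex_structure J"
    and complex_linear: "complex_linear_op J T"
    and alpha_pos: "0 < \<alpha>"
    and norm_mean_le: "\<And>n. norm (cesaro_mean \<alpha> T n) \<le> C"
begin

lemma C_nonneg: "0 \<le> C"
  using norm_mean_le[of 0] norm_ge_zero order_trans by blast

definition mean_orbit :: "int \<Rightarrow> 'a \<Rightarrow>\<^sub>L 'a" where
  "mean_orbit k = (if 0 \<le> k then cesaro_mean \<alpha> T (nat k) else 0)"

sublocale asymptotic_orbit "cscaleL J" "(o\<^sub>L) T" mean_orbit C
proof (intro asymptotic_orbit.intro asymptotic_orbit_axioms.intro complex_banach_cscaleL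
    complex_structure)
  show "bounded_linear ((o\<^sub>L) T)"
    by (rule blinfun_compose.bounded_linear_right)
  show "T o\<^sub>L cscaleL J a A = cscaleL J a (T o\<^sub>L A)" for a A
    using complex_linear by (simp add: compose_cscaleL complex_linear_op_def)
  show "norm (mean_orbit k) \<le> C" for k
    using norm_mean_le C_nonneg by (simp add: mean_orbit_def)
  show "(defect ((o\<^sub>L) T) mean_orbit \<longlongrightarrow> 0) at_top"
  proof (rule Lim_transform_eventually)
    show "((\<lambda>k. (T o\<^sub>L cesaro_mean \<alpha> T (nat k)) - cesaro_mean \<alpha> T (Suc (nat k))) \<longlongrightarrow> 0) at_top"
      by (rule filterlim_compose[OF cesaro_mean_shift_tendsto_0[OF alpha_pos norm_mean_le]
          filterlim_nat_sequentially])
    show "\<forall>\<^sub>F k in at_top. (T o\<^sub>L cesaro_mean \<alpha> T (nat k)) - cesaro_mean \<alpha> T (Suc (nat k))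
        = defect ((o\<^sub>L) T) mean_orbit k"
      using eventually_ge_at_top[of 0]
      by eventually_elim (simp add: defect_def mean_orbit_def nat_add_distrib)
  qed
qed

lemma approx_spectrum_subset: "approx_spectrum ((o\<^sub>L) T) \<subseteq> op_spectrum J T"
proof
  fix z assume z: "z \<in> approx_spectrum ((o\<^sub>L) T)"
  have False if resolvent: "z \<notin> op_spectrum J T"
  proof -
    obtain S where S: "S o\<^sub>L (cscaleL J z id_blinfun - T) = id_blinfun"
      using resolvent unfolding op_spectrum_def by blast
    have "norm A \<le> (norm S + 1) * norm (cscaleL J z A - (T o\<^sub>L A))" for A
    proof -
      have "A = (S o\<^sub>L (cscaleL J z id_blinfun - T)) o\<^sub>L A"
        by (simp add: S)
      also have "\<dots> = S o\<^sub>L (cscaleL J z A - (T o\<^sub>L A))"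
        by (simp add: blinfun_compose_assoc blinfun_compose.diff_left cscaleL_compose)
      finally have "norm A \<le> norm S * norm (cscaleL J z A - (T o\<^sub>L A))"
        by (metis norm_blinfun_compose)
      then show ?thesis
        by (simp add: distrib_right add_increasing2)
    qed
    then have "resolvent_bound (norm S + 1) ((o\<^sub>L) T) z"
      by (auto simp: resolvent_bound_def add_nonneg_pos)
    then show False
      using z by (auto simp: approx_spectrum_def)
  qed
  then show "z \<in> op_spectrum J T"
    by blast
qed

lemma mean_opow_tendsto_0: "(\<lambda>n. (cesaro_mean \<alpha> T n o\<^sub>L opow T j) - cesaro_mean \<alpha> T (n + j)) \<longlonglongrightarrow> 0"
proof -
  have "(\<lambda>n. (opow T j o\<^sub>L cesaro_mean \<alpha> T n) - cesaro_mean \<alpha> T (n + j)) \<longlonglongrightarrow> 0"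
  proof (induction j)
    case (Suc j)
    have "(\<lambda>n. (T o\<^sub>L ((opow T j o\<^sub>L cesaro_mean \<alpha> T n) - cesaro_mean \<alpha> T (n + j)))
        + ((T o\<^sub>L cesaro_mean \<alpha> T (n + j)) - cesaro_mean \<alpha> T (Suc (n + j)))) \<longlonglongrightarrow> (T o\<^sub>L 0) + 0"
      by (intro tendsto_add blinfun_compose.tendsto Suc tendsto_const
          LIMSEQ_ignore_initial_segment[OF cesaro_mean_shift_tendsto_0[OF alpha_pos norm_mean_le]])
    then show ?case
      by (simp add: opow_Suc blinfun_compose_linear blinfun_compose_assoc)
  qed simp
  moreover have "cesaro_mean \<alpha> T n o\<^sub>L opow T j = opow T j o\<^sub>L cesaro_mean \<alpha> T n" for n
    by (rule cesaro_mean_commute[OF opow_commute[OF refl, symmetric]])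
  ultimately show ?thesis
    by simp
qed

lemma norm_cesaro_sum_le: "norm (cesaro_sum \<alpha> T n) \<le> C * kc (\<alpha> + 1) n"
  using mult_right_mono[OF norm_mean_le, of "kc (\<alpha> + 1) n" n] alpha_pos
  by (simp add: cesaro_sum_eq_mean kc_nonneg mult.commute)

definition sum_defect :: "nat \<Rightarrow> nat \<Rightarrow> 'a \<Rightarrow>\<^sub>L 'a" where
  "sum_defect n k = (cesaro_mean \<alpha> T n o\<^sub>L cesaro_sum \<alpha> T k)
    - (\<Sum>j\<le>k. kc \<alpha> (k - j) *\<^sub>R cesaro_mean \<alpha> T (n + j))"

lemma sum_defect_tendsto_0: "(\<lambda>n. sum_defect n k) \<longlonglongrightarrow> 0"
proof -
  let ?e = "\<lambda>j n. (cesaro_mean \<alpha> T n o\<^sub>L opow T j) - cesaro_mean \<alpha> T (n + j)"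
  have "sum_defect n k = (\<Sum>j\<le>k. kc \<alpha> (k - j) *\<^sub>R ?e j n)" for n
    by (simp add: sum_defect_def cesaro_sum_def blinfun_compose_linear sum_subtractf
        scaleR_right_diff_distrib)
  moreover have "(\<lambda>n. \<Sum>j\<le>k. kc \<alpha> (k - j) *\<^sub>R ?e j n) \<longlonglongrightarrow> (\<Sum>j\<le>k. kc \<alpha> (k - j) *\<^sub>R 0)"
    by (intro tendsto_sum tendsto_scaleR tendsto_const mean_opow_tendsto_0)
  ultimately show ?thesis by simp
qed

lemma norm_sum_defect_le: "norm (sum_defect n k) \<le> (C * C + C) * kc (\<alpha> + 1) k"
proof -
  have "norm (cesaro_mean \<alpha> T n o\<^sub>L cesaro_sum \<alpha> T k) \<le> C * (C * kc (\<alpha> + 1) k)"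
    by (rule order_trans[OF norm_blinfun_compose])
      (intro mult_mono norm_mean_le norm_cesaro_sum_le C_nonneg norm_ge_zero)
  moreover have "norm (\<Sum>j\<le>k. kc \<alpha> (k - j) *\<^sub>R cesaro_mean \<alpha> T (n + j)) \<le> (\<Sum>j\<le>k. kc \<alpha> (k - j) * C)"
    by (rule sum_norm_le) (use alpha_pos norm_mean_le in \<open>simp add: kc_nonneg mult_left_mono\<close>)
  ultimately have "norm (sum_defect n k) \<le> C * (C * kc (\<alpha> + 1) k) + (\<Sum>j\<le>k. kc \<alpha> (k - j) * C)"
    unfolding sum_defect_def by (rule norm_triangle_le_diff[OF add_mono])
  also have "\<dots> = (C * C + C) * kc (\<alpha> + 1) k"
    by (simp only: sum_distrib_right[symmetric] sum_kc) (simp add: algebra_simps)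
  finally show ?thesis .
qed

lemma theta_has_sum:
  assumes W: "kc_summable (\<alpha> + 1) (\<lambda>k. Wp \<alpha> f (int k))"
  shows "((\<lambda>k. cscaleL J (Wp \<alpha> f (int k)) (cesaro_sum \<alpha> T k)) has_sum theta J \<alpha> T f) UNIV"
proof -
  have "(\<lambda>k. C * (kc (\<alpha> + 1) k * norm (Wp \<alpha> f (int k)))) summable_on UNIV"
    using W unfolding kc_summable_def by (rule summable_on_cmult_right)
  moreover have "norm (cscaleL J (Wp \<alpha> f (int k)) (cesaro_sum \<alpha> T k))
      \<le> C * (kc (\<alpha> + 1) k * norm (Wp \<alpha> f (int k)))" for k
    using mult_left_mono[OF norm_cesaro_sum_le norm_ge_zero, of "Wp \<alpha> f (int k)" k]
    by (simp add: norm_scale mult_ac)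
  ultimately have sum: "((\<lambda>k. cscaleL J (Wp \<alpha> f (int k)) (cesaro_sum \<alpha> T k)) has_sum
      (\<Sum>\<^sub>\<infinity>k. cscaleL J (Wp \<alpha> f (int k)) (cesaro_sum \<alpha> T k))) UNIV"
    by (rule has_sum_infsum_dominated)
  then show ?thesis
    using has_sum_imp_sums[OF sum] by (simp add: theta_def sums_iff)
qed

lemma correlation_mean_orbit_has_sum:
  assumes f: "(\<lambda>j. norm (f j)) summable_on UNIV" and f0: "\<And>n. n < 0 \<Longrightarrow> f n = 0"
    and W: "kc_summable (\<alpha> + 1) (\<lambda>k. Wp \<alpha> f (int k))"
  shows "((\<lambda>k. cscaleL J (Wp \<alpha> f (int k)) (\<Sum>j\<le>k. kc \<alpha> (k - j) *\<^sub>R cesaro_mean \<alpha> T (n + j)))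
      has_sum correlation f mean_orbit (int n)) UNIV"
proof -
  let ?W = "weyl_diff \<alpha> (\<lambda>k. f (int k))"
  have weyl_summable: "kc_summable (1 + \<alpha>) ?W"
    using W by (simp add: Wp_nat add.commute)
  have inversion: "weyl_sum \<alpha> ?W = (\<lambda>k. f (int k))"
    using summable_on_int_nonneg[OF f] W
    by (intro weyl_sum_weyl_diff alpha_pos) (simp_all add: Wp_nat kc_summable_one_iff)
  have "((\<lambda>k. cscaleL J (?W k) (\<Sum>j\<le>k. kc \<alpha> (k - j) *\<^sub>R cesaro_mean \<alpha> T (n + j))) has_sum
      (\<Sum>\<^sub>\<infinity>j. cscaleL J (weyl_sum \<alpha> ?W j) (cesaro_mean \<alpha> T (n + j)))) UNIV"
    by (rule has_sum_cesaro_sum_prod[OF scale.flip, where a = 1 and C = C])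
      (use alpha_pos norm_mean_le weyl_summable in auto)
  moreover have "(\<Sum>\<^sub>\<infinity>j. cscaleL J (weyl_sum \<alpha> ?W j) (cesaro_mean \<alpha> T (n + j)))
      = correlation f mean_orbit (int n)"
  proof -
    have "(\<lambda>j. cscaleL J (f j) (mean_orbit (int n + j))) summable_on UNIV"
      by (rule has_sum_imp_summable[OF correlation_has_sum[OF f norm_orbit_le]])
    moreover have "(\<Sum>\<^sub>\<infinity>j. cscaleL J (f (- 1 - int j)) (mean_orbit (int n + (- 1 - int j)))) = 0"
      by (rule infsum_0) (simp add: f0 scale.zero_left)
    ultimately have "correlation f mean_orbit (int n)
        = (\<Sum>\<^sub>\<infinity>j. cscaleL J (f (int j)) (mean_orbit (int n + int j)))"
      unfolding correlation_def by (simp only: infsum_int_split add_0_right)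
    then show ?thesis
      by (simp add: inversion mean_orbit_def nat_add_distrib)
  qed
  ultimately show ?thesis
    by (simp add: Wp_nat)
qed

theorem mean_theta_tendsto_0:
  assumes f: "(\<lambda>j. norm (f j)) summable_on UNIV" and f0: "\<And>n. n < 0 \<Longrightarrow> f n = 0"
    and W: "kc_summable (\<alpha> + 1) (\<lambda>k. Wp \<alpha> f (int k))"
  shows "(\<lambda>n. (cesaro_mean \<alpha> T n o\<^sub>L theta J \<alpha> T f) - correlation f mean_orbit (int n)) \<longlonglongrightarrow> 0"
proof -
  let ?W = "\<lambda>k. Wp \<alpha> f (int k)"
  have "(cesaro_mean \<alpha> T n o\<^sub>L theta J \<alpha> T f) - correlation f mean_orbit (int n)
      = (\<Sum>\<^sub>\<infinity>k. cscaleL J (?W k) (sum_defect n k))" for n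
  proof -
    have "cesaro_mean \<alpha> T n o\<^sub>L J = J o\<^sub>L cesaro_mean \<alpha> T n"
      using complex_linear by (simp add: cesaro_mean_commute complex_linear_op_def)
    then have "((\<lambda>k. cscaleL J (?W k) (cesaro_mean \<alpha> T n o\<^sub>L cesaro_sum \<alpha> T k)) has_sum
        (cesaro_mean \<alpha> T n o\<^sub>L theta J \<alpha> T f)) UNIV"
      using has_sum_bounded_linear[OF blinfun_compose.bounded_linear_right theta_has_sum[OF W],
          of "cesaro_mean \<alpha> T n"]
      by (simp add: compose_cscaleL)
    from has_sum_diff[OF this correlation_mean_orbit_has_sum[OF f f0 W, where n = n]] show ?thesis
      by (simp add: sum_defect_def scale.diff_right infsumI)
  qed
  moreover have "(\<lambda>n. \<Sum>\<^sub>\<infinity>k. cscaleL J (?W k) (sum_defect n k)) \<longlonglongrightarrow> (\<Sum>\<^sub>\<infinity>k::nat. 0)"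
  proof (rule tendsto_infsum_dominated)
    show "(\<lambda>n. cscaleL J (?W k) (sum_defect n k)) \<longlonglongrightarrow> 0" for k
      using scale.tendsto[OF tendsto_const sum_defect_tendsto_0] by (simp add: scale.zero_right)
    show "\<forall>\<^sub>F n in sequentially. \<forall>k\<in>UNIV.
        norm (cscaleL J (?W k) (sum_defect n k)) \<le> norm (?W k) * ((C * C + C) * kc (\<alpha> + 1) k)"
      unfolding norm_scale
      by (intro always_eventually allI ballI mult_left_mono norm_sum_defect_le norm_ge_zero)
    show "(\<lambda>k. norm (?W k) * ((C * C + C) * kc (\<alpha> + 1) k)) summable_on UNIV"
      using summable_on_cmult_right[OF W[unfolded kc_summable_def], of "C * C + C"]
      by (simp add: mult_ac)
  qed simp
  ultimately show ?thesis by simp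
qed

lemma norm_correlation_fourier_diff_le:
  assumes g: "g \<in> A_alpha \<alpha>" and h: "h \<in> A_alpha \<alpha>"
  shows "norm (correlation (fourier_coeff g) mean_orbit n
      - correlation (fourier_coeff h) mean_orbit n)
    \<le> A_norm \<alpha> (\<lambda>t. g t - h t) * C"
proof -
  have "fourier_coeff (\<lambda>t. g t - h t) j = fourier_coeff g j - fourier_coeff h j" for j
    using g h by (intro fourier_coeff_diff) (auto simp: A_alpha_def)
  then have "(\<Sum>\<^sub>\<infinity>j. norm (fourier_coeff g j - fourier_coeff h j)) \<le> A_norm \<alpha> (\<lambda>t. g t - h t)"
    using l1_norm_fourier_coeff_le_A_norm[OF alpha_pos A_alpha_diff[OF alpha_pos g h]] by simp
  with norm_correlation_diff_le[OF A_alpha_fourier_coeff_summable[OF g]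
      A_alpha_fourier_coeff_summable[OF h] norm_orbit_le]
  show ?thesis
    by (rule order_trans[OF _ mult_right_mono[OF _ C_nonneg]])
qed

theorem correlation_synthesis_tendsto_0:
  assumes g: "g \<in> A_alpha \<alpha>"
    and synthesis: "spectral_synthesis \<alpha> g {t. exp (\<i> * of_real t) \<in> op_spectrum J T}"
  shows "(correlation (fourier_coeff g) mean_orbit \<longlongrightarrow> 0) at_top"
proof -
  let ?E = "{t. cis t \<in> op_spectrum J T}"
  have "\<forall>\<epsilon>>0. \<exists>h. h \<in> A_alpha \<alpha> \<and> A_norm \<alpha> (\<lambda>t. g t - h t) < \<epsilon> \<and> vanishes_near ?E h"
    using synthesis unfolding spectral_synthesis_def vanishes_near_def cis_conv_exp by blast
  then obtain h where h: "\<And>\<epsilon>. 0 < \<epsilon> \<Longrightarrow> h \<epsilon> \<in> A_alpha \<alpha>"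
    and close: "\<And>\<epsilon>. 0 < \<epsilon> \<Longrightarrow> A_norm \<alpha> (\<lambda>t. g t - h \<epsilon> t) < \<epsilon>"
    and vanish: "\<And>\<epsilon>. 0 < \<epsilon> \<Longrightarrow> vanishes_near ?E (h \<epsilon>)"
    by metis
  define b where "b \<epsilon> n = norm (correlation (fourier_coeff (h \<epsilon>)) mean_orbit n) + \<epsilon> * C" for \<epsilon> n
  have pos: "\<forall>\<^sub>F \<epsilon> in at_right 0. 0 < (\<epsilon>::real)"
    by (rule eventually_at_right_less)
  show ?thesis
  proof (rule tendsto_0_by_approximation)
    from pos show "\<forall>\<^sub>F \<epsilon> in at_right 0. \<forall>n. norm (correlation (fourier_coeff g) mean_orbit n)
        \<le> b \<epsilon> n"
    proof eventually_elim
      case (elim \<epsilon>)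
      have "norm (correlation (fourier_coeff g) mean_orbit n
          - correlation (fourier_coeff (h \<epsilon>)) mean_orbit n) \<le> \<epsilon> * C" for n
        by (rule order_trans[OF norm_correlation_fourier_diff_le[OF g h[OF elim]]
              mult_right_mono[OF less_imp_le[OF close[OF elim]] C_nonneg]])
      then show ?case
        unfolding b_def by (intro allI order_trans[OF norm_triangle_sub add_left_mono])
    qed
    from pos show "\<forall>\<^sub>F \<epsilon> in at_right 0. (b \<epsilon> \<longlongrightarrow> \<epsilon> * C) at_top"
    proof eventually_elim
      case (elim \<epsilon>)
      have "vanishes_near {t. cis t \<in> approx_spectrum ((o\<^sub>L) T)} (h \<epsilon>)"
        using vanish[OF elim] approx_spectrum_subset unfolding vanishes_near_def by blast
      then have "(correlation (fourier_coeff (h \<epsilon>)) mean_orbit \<longlongrightarrow> 0) at_top"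
        using h[OF elim]
        by (intro correlation_fourier_tendsto_0 A_alpha_fourier_coeff_summable[OF h[OF elim]])
          (simp add: A_alpha_def)
      then show ?case
        unfolding b_def[abs_def] by (auto intro!: tendsto_eq_intros)
    qed
    show "((\<lambda>\<epsilon>. \<epsilon> * C) \<longlongrightarrow> 0) (at_right 0)"
      by (auto intro!: tendsto_eq_intros)
  qed simp
qed

end

theorem theorem3p4:
  fixes J T :: "'a::banach \<Rightarrow>\<^sub>L 'a" and \<alpha> :: real and g :: "real \<Rightarrow> complex"
  assumes "complex_structure J"
    and "complex_linear_op J T"
    and "\<alpha> > 0"
    and "C_bounded \<alpha> T"
    and "g \<in> A_alpha_plus \<alpha>"
    and "spectral_synthesis \<alpha> g {t. exp (\<i> * of_real t) \<in> op_spectrum J T}"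
  shows "(\<lambda>n. norm (cesaro_mean \<alpha> T n o\<^sub>L theta J \<alpha> T (fourier_coeff g))) \<longlonglongrightarrow> 0"
proof -
  obtain C where "\<And>n. norm (cesaro_mean \<alpha> T n) \<le> C"
    using assms(4) by (auto simp: C_bounded_def)
  then interpret cesaro_bounded_op J T \<alpha> C
    by unfold_locales (use assms in auto)
  have g: "g \<in> A_alpha \<alpha>" and g0: "\<And>n. n < 0 \<Longrightarrow> fourier_coeff g n = 0"
    using assms(5) by (auto simp: A_alpha_plus_def)
  have "(\<lambda>n. (cesaro_mean \<alpha> T n o\<^sub>L theta J \<alpha> T (fourier_coeff g))
      - correlation (fourier_coeff g) mean_orbit (int n)) \<longlonglongrightarrow> 0"
    using g g0 by (intro mean_theta_tendsto_0 A_alpha_fourier_coeff_summable A_alpha_Wp_summable)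
  moreover have "(\<lambda>n. correlation (fourier_coeff g) mean_orbit (int n)) \<longlonglongrightarrow> 0"
    using correlation_synthesis_tendsto_0[OF g assms(6)] filterlim_int_sequentially
    by (rule filterlim_compose)
  ultimately have "(\<lambda>n. cesaro_mean \<alpha> T n o\<^sub>L theta J \<alpha> T (fourier_coeff g)) \<longlonglongrightarrow> 0"
    by (rule Lim_transform[rotated])
  then show ?thesis
    by (rule tendsto_norm_zero)
qed

end
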